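(* Let $\ell$ be a well-typed positive let-term and $x$ a positive variable defined in $\ell$ but not occurring in the output of $\ell$. Then $$\mathrm{Facts}(\mathrm{VE}_L(\ell,x))=\mathrm{VE}_F(\mathrm{Facts}(\ell),x).$$
   Context: Types: positive $P,Q::=\mathsf{Bool}\mid P\otimes Q$; arrow $N::=P\multimap T$; let-term types $T,U::=P\mid N\mid P\otimes T$. Each variable carries a fixed type $\mathsf{ty}(v)$, positive or arrow; $x,y,z$ positive variables, $f,g,h$ arrow variables. Webs: $|\mathsf{Bool}|=\{\mathsf t,\mathsf f\}$, $|P\otimes T|=|P\multimap T|=|P|\times|T|$. Constants $M$: stochastic matrices in $\mathbb R_{\ge0}^{|P|\times|Q|}$ of type $P\multimap Q$ (or $0$-ary probability vectors of type $Q$). Syntax: patterns $\vec v::=v\mid(\vec v,\vec v')$ (components with disjoint variables; positive if all variables positive); expressions $e::=v\mid M(\vec x)\mid f\,\vec x\mid (e,e')\mid \lambda\vec x.e\mid \mathtt{let}\ \vec v=e\ \mathtt{in}\ e'$ ($\vec x$ positive pattern); let-terms $\ell::=\vec v\mid \mathtt{let}\ \vec v=e\ \mathtt{in}\ \ell$. Typing: $v:\mathsf{ty}(v)$; $f:P\multimap T,\vec x:P\Rightarrow f\vec x:T$; $M:P\multimap Q,\vec x:P\Rightarrow M(\vec x):Q$; $\vec x:P,e:T\Rightarrow\lambda\vec x.e:P\multimap T$; $e:P,e':T$, $FV^a(e)\cap FV^a(e')=\emptyset\Rightarrow(e,e'):P\otimes T$; $\vec v:T,e:T,e':U$, $FV^a(e)\cap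 FV^a(e')=\emptyset$, each arrow variable of $\vec v$ in $FV^a(e')$ $\Rightarrow\mathtt{let}\ \vec v=e\ \mathtt{in}\ e':U$. $\vec v^a$: the arrow variable of a pattern (at most one); $\vec v^+$: the pattern without it; if $\vec v^+$ is empty, $(\vec v^+,e)$ stands for $e$. $(\vec v_1=e_1;\dots;\vec v_n=e_n\ \mathtt{in}\ \vec w)$ abbreviates nested lets; definitions $\vec v_i=e_i$, output $\vec w$, defined variables those of the $\vec v_i$; positive let-term: positive output. Bound variables pairwise distinct and distinct from free ones. Semantics: $|V|=\prod_{v\in V}|\mathsf{ty}(v)|$ (functions; restriction $a|_{V'}$; union $a\uplus b$); elements of $|FV(\vec v)|$ identified with $|\mathsf{ty}(\vec v)|$. $[\![e]\!]\in\mathbb R_{\ge0}^{|FV(e)|\times|\mathsf{ty}(e)|}$: $[\![v]\!]_{a,b}=\delta_{a_v,b}$; $[\![(e',e'')]\!]_{a,(b',b'')}=[\![e']\!]_{a|_{FV(e')},b'}[\![e'']\!]_{a|_{FV(e'')},b''}$; $[\![\mathtt{let}\ \vec v=e'\ \mathtt{in}\ e'']\!]_{a,b}=\sum_{c\in|FV(\vec v)|}[\![e']\!]_{a|_{FV(e')},c}[\![e'']\!]_{(a\uplus c)|_{FV(e'')},b}$; $[\![\lambda\vec v.e']\!]_{a,(b',b'')}=[\![e']\!]_{(a\uplus b')|_{FV(e')},b''}$; $[\![M(\vec x)]\!]_{a,b}=M_{a,b}$; $[\![f\vec x]\!]_{a,b}=\delta_{a',a'''}\delta_{a'',b}$ with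 $a_f=(a',a'')$, $a|_{\vec x}=a'''$. Factors: $(\mathrm{Var}(\varphi),\varphi:|\mathrm{Var}(\varphi)|\to\mathbb R_{\ge0})$; $\mathrm{Var}(\sum_S\varphi)=\mathrm{Var}(\varphi)\setminus S$, $(\sum_S\varphi)(a)=\sum_{b\in|S\cap\mathrm{Var}(\varphi)|}\varphi(a\uplus b)$; $\mathrm{Var}(\varphi\odot\psi)=\mathrm{Var}(\varphi)\cup\mathrm{Var}(\psi)$, $(\varphi\odot\psi)(c)=\varphi(c|_{\mathrm{Var}(\varphi)})\psi(c|_{\mathrm{Var}(\psi)})$. For finite $\Gamma$: $\bigodot\Gamma$ product; $\Gamma_V=\{\varphi\in\Gamma:\mathrm{Var}(\varphi)\cap V\ne\emptyset\}$, $\Gamma_{\neg V}=\Gamma\setminus\Gamma_V$ ($\Gamma_v$ for $V=\{v\}$). $\mathrm{Fact}(\vec v=e)$: variables $FV(e)\uplus FV(\vec v)$, function $a\uplus c\mapsto[\![e]\!]_{a,c}$. $\mathrm{Facts}(\vec w)=\{(FV(\vec w),a\mapsto1)\}$; for $\ell$ with output $\vec w$, $\mathrm{Facts}(\mathtt{let}\ \vec v=e\ \mathtt{in}\ \ell)=\{\sum_{\{f\}}(\mathrm{Fact}(\vec v=e)\odot\bigodot\mathrm{Facts}(\ell)_f)\}\uplus\mathrm{Facts}(\ell)_{\neg f}$ if $\vec v$ contains an arrow variable $f\notin FV(\vec w)$, and $\{\mathrm{Fact}(\vec v=e)\}\uplus\mathrm{Facts}(\ell)$ otherwise. Bound variable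 names are used as factor variable names. Variable elimination on factors: $\mathrm{VE}_F(\Gamma,v)=\{\sum_{\{v\}}\bigodot\Gamma_v\}\uplus\Gamma_{\neg v}$. $\mathrm{SD}$, for $\ell=(\vec v_1=e_1;\vec v_2=e_2\ \mathtt{in}\ \ell')$: (1) if $FV(\vec v_1)\cap FV(e_2)=\emptyset$, $(\vec v_2=e_2;\vec v_1=e_1\ \mathtt{in}\ \ell')$; (2) if $FV(\vec v_1)\cap FV(e_2)=\vec x$ non-empty positive, $(g=\lambda\vec x.e_2;\vec v_1=e_1;\vec v_2=g\vec x\ \mathtt{in}\ \ell')$ ($g$ fresh); (3) if $\vec v_1^a=f\in FV(e_2)$, $((\vec v_1^+,\vec v_2)=(\mathtt{let}\ \vec v_1=e_1\ \mathtt{in}\ (\vec v_1^+,e_2))\ \mathtt{in}\ \ell')$ if $\vec v_1^+$ non-empty, else $(\vec v_2=(\mathtt{let}\ \vec v_1=e_1\ \mathtt{in}\ e_2)\ \mathtt{in}\ \ell')$. $\mathrm{VA}(\ell,\mathcal V)$, for positive $\ell=(\mathtt{let}\ \vec v_1=e_1\ \mathtt{in}\ \ell_1)$ and $\mathcal V\subseteq FV(\ell)$ disjoint from the output: (1) $\mathcal V=\emptyset$: $\ell$; (2) $\mathcal V\cap FV(e_1)=\emptyset$: $\mathrm{SD}(\mathtt{let}\ \vec v_1=e_1\ \mathtt{in}\ \mathrm{VA}(\ell_1,\mathcal V))$; (3) $\mathcal V\cap FV(e_1)\ne\emptyset$, $\vec v_1$ positive, $\mathrm{VA}(\ell_1,\mathcal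 V\cap FV(\ell_1))=(\mathtt{let}\ \vec v'=e'\ \mathtt{in}\ \ell')$: $((\vec v_1,\vec v')=(\mathtt{let}\ \vec v_1=e_1\ \mathtt{in}\ (\vec v_1,e'))\ \mathtt{in}\ \ell')$; (4) $\mathcal V\cap FV(e_1)\ne\emptyset$, $\vec v_1^a=f$, $\mathrm{VA}(\ell_1,(\mathcal V\cap FV(\ell_1))\cup\{f\})=(\mathtt{let}\ \vec v'=e'\ \mathtt{in}\ \ell')$: $((\vec v_1^+,\vec v')=(\mathtt{let}\ \vec v_1=e_1\ \mathtt{in}\ (\vec v_1^+,e'))\ \mathtt{in}\ \ell')$ if $\vec v_1^+$ non-empty, else $(\vec v'=(\mathtt{let}\ \vec v_1=e_1\ \mathtt{in}\ e')\ \mathtt{in}\ \ell')$. $\mathrm{VE}_L(\ell,x)$, for positive $\ell=(\mathtt{let}\ \vec v_1=e_1\ \mathtt{in}\ \ell_1)$ and positive $x$ defined in $\ell$ but not in the output, by induction; $\vec v_1'$ is $\vec v_1$ with $x$ removed: (1) if $x\in FV(\vec v_1)$, $x\notin FV(\ell_1)$: $(\mathtt{let}\ \vec v_1'=(\mathtt{let}\ \vec v_1=e_1\ \mathtt{in}\ \vec v_1')\ \mathtt{in}\ \ell_1)$; (2) if $x\in FV(\vec v_1)\cap FV(\ell_1)$: (a) if $\vec v_1'$ positive, with $(\mathtt{let}\ \vec v'=e'\ \mathtt{in}\ \ell')=\mathrm{VA}(\ell_1,\{x\})$: $((\vec v_1',\vec v')=(\mathtt{let}\ \vec v_1=e_1\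 \mathtt{in}\ (\vec v_1',e'))\ \mathtt{in}\ \ell')$; (b) if $(\vec v_1')^a=f$, with $(\mathtt{let}\ \vec v'=e'\ \mathtt{in}\ \ell')=\mathrm{VA}(\ell_1,\{x,f\})$: $(((\vec v_1')^+,\vec v')=(\mathtt{let}\ \vec v_1=e_1\ \mathtt{in}\ ((\vec v_1')^+,e'))\ \mathtt{in}\ \ell')$; in both subcases, if $(\vec v_1')^+$ is empty, the result is $(\mathtt{let}\ \vec v'=(\mathtt{let}\ \vec v_1=e_1\ \mathtt{in}\ e')\ \mathtt{in}\ \ell')$; (3) if $x\notin FV(\vec v_1)$: $\mathrm{SD}(\mathtt{let}\ \vec v_1=e_1\ \mathtt{in}\ \mathrm{VE}_L(\ell_1,x))$.
   Formalization: VA case (3) is corrected: if v1 is positive and V∩FV(ℓ1)=∅, VA returns ℓ unchanged (the literal rule merges an unrelated definition, making the claim false, or is undefined). VE_L case (1) with v1=x leaves a definition with an empty pattern, added to the syntax. *)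

theory Defs
  imports Complex_Main "HOL-Library.FuncSet" "HOL-Library.Multiset"
begin

section \<open>Types, webs and variables\<close>

text \<open>
  The constructor \<open>TUnit\<close>, together with \<open>PUnit\<close> and \<open>EUnit\<close> below, is not part of the
  calculus: no typing rule mentions it, so it does not occur in a well-typed term.  It
  represents the empty pattern that is left when the only variable of a definition is removed
  from its pattern.
\<close>

datatype ty = TBool | Tens ty ty | Lolli ty ty | TUnit

fun positive :: "ty \<Rightarrow> bool" where
  "positive TBool = True"
| "positive (Tens P Q) = (positive P \<and> positive Q)"
| "positive (Lolli P T) = False"
| "positive TUnit = False"

fun wf_ty :: "ty \<Rightarrow> bool" where
  "wf_ty TBool = True"
| "wf_ty (Tens P T) = (positive P \<and> wf_ty T)"
| "wf_ty (Lolli P T) = (positive P \<and> wf_ty T)"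
| "wf_ty TUnit = False"

datatype elt = Tt | Ff | Pr elt elt | Star

fun web :: "ty \<Rightarrow> elt set" where
  "web TBool = {Tt, Ff}"
| "web (Tens P T) = {Pr a b | a b. a \<in> web P \<and> b \<in> web T}"
| "web (Lolli P T) = {Pr a b | a b. a \<in> web P \<and> b \<in> web T}"
| "web TUnit = {Star}"

datatype var = Var (nm: nat) (ty: ty)

definition pos_var :: "var \<Rightarrow> bool" where
  "pos_var v \<longleftrightarrow> positive (ty v)"

definition arrow_var :: "var \<Rightarrow> bool" where
  "arrow_var v \<longleftrightarrow> (\<exists>P T. ty v = Lolli P T)"

definition var_ok :: "var \<Rightarrow> bool" where
  "var_ok v \<longleftrightarrow> wf_ty (ty v) \<and> (pos_var v \<or> arrow_var v)"

text \<open>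
  The set \<open>|V|\<close>.  Restriction of assignments is \<^const>\<open>restrict\<close>; the union of
  \<open>a \<in> |V|\<close> and \<open>b \<in> |V'|\<close> is \<open>override_on a b V'\<close>.
\<close>

definition assigns :: "var set \<Rightarrow> (var \<Rightarrow> elt) set" where
  "assigns V = (\<Pi>\<^sub>E v\<in>V. web (ty v))"


section \<open>Patterns, expressions, let-terms\<close>

datatype pat = PVar var | PPair pat pat | PUnit

fun pvar_list :: "pat \<Rightarrow> var list" where
  "pvar_list (PVar v) = [v]"
| "pvar_list (PPair p q) = pvar_list p @ pvar_list q"
| "pvar_list PUnit = []"

definition pvars :: "pat \<Rightarrow> var set" where
  "pvars p = set (pvar_list p)"

definition linear_pat :: "pat \<Rightarrow> bool" where
  "linear_pat p \<longleftrightarrow> distinct (pvar_list p)"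

definition pos_pat :: "pat \<Rightarrow> bool" where
  "pos_pat p \<longleftrightarrow> (\<forall>v\<in>pvars p. pos_var v)"

fun pty :: "pat \<Rightarrow> ty" where
  "pty (PVar v) = ty v"
| "pty (PPair p q) = Tens (pty p) (pty q)"
| "pty PUnit = TUnit"

text \<open>The identification of \<open>|FV(p)|\<close> with \<open>|ty(p)|\<close>.\<close>

fun pval :: "pat \<Rightarrow> (var \<Rightarrow> elt) \<Rightarrow> elt" where
  "pval (PVar v) a = a v"
| "pval (PPair p q) a = Pr (pval p a) (pval q a)"
| "pval PUnit a = Star"

definition pasg :: "pat \<Rightarrow> elt \<Rightarrow> (var \<Rightarrow> elt)" where
  "pasg p = inv_into (assigns (pvars p)) (pval p)"

text \<open>The pattern of the variables satisfying a predicate, \<open>PUnit\<close> if there are none.\<close>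

fun pfilter :: "(var \<Rightarrow> bool) \<Rightarrow> pat \<Rightarrow> pat" where
  "pfilter R (PVar v) = (if R v then PVar v else PUnit)"
| "pfilter R (PPair p q) =
     (if pfilter R p = PUnit then pfilter R q
      else if pfilter R q = PUnit then pfilter R p
      else PPair (pfilter R p) (pfilter R q))"
| "pfilter R PUnit = PUnit"

definition ppos :: "pat \<Rightarrow> pat" where
  "ppos p = pfilter (\<lambda>v. \<not> arrow_var v) p"

definition pdel :: "var \<Rightarrow> pat \<Rightarrow> pat" where
  "pdel x p = pfilter (\<lambda>v. v \<noteq> x) p"

definition parrow :: "pat \<Rightarrow> var option" where
  "parrow p = List.find arrow_var (pvar_list p)"

text \<open>
  In \<open>EVec Q m\<close> and \<open>EMat P Q M p\<close> the constant comes with its type; \<open>m\<close> and \<open>M\<close> are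
  relevant on the webs only.
\<close>

datatype exp =
    EVar var
  | EVec ty "elt \<Rightarrow> real"
  | EMat ty ty "elt \<Rightarrow> elt \<Rightarrow> real" pat
  | EApp var pat
  | EPair exp exp
  | ELam pat exp
  | ELet pat exp exp
  | EUnit

datatype lterm = Out pat | LLet pat exp lterm

fun pexp :: "pat \<Rightarrow> exp" where
  "pexp (PVar v) = EVar v"
| "pexp (PPair p q) = EPair (pexp p) (pexp q)"
| "pexp PUnit = EUnit"

fun lexp :: "lterm \<Rightarrow> exp" where
  "lexp (Out p) = pexp p"
| "lexp (LLet p e l) = ELet p e (lexp l)"

text \<open>The pairs \<open>(p, q)\<close> and \<open>(p, e)\<close>, which stand for \<open>q\<close> and \<open>e\<close> if \<open>p\<close> is empty.\<close>

definition ppair :: "pat \<Rightarrow> pat \<Rightarrow> pat" where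
  "ppair p q = (if p = PUnit then q else PPair p q)"

definition epair :: "pat \<Rightarrow> exp \<Rightarrow> exp" where
  "epair p e = (if p = PUnit then e else EPair (pexp p) e)"

fun FV :: "exp \<Rightarrow> var set" where
  "FV (EVar v) = {v}"
| "FV (EVec Q m) = {}"
| "FV (EMat P Q M p) = pvars p"
| "FV (EApp f p) = insert f (pvars p)"
| "FV (EPair e e') = FV e \<union> FV e'"
| "FV (ELam p e) = FV e - pvars p"
| "FV (ELet p e e') = FV e \<union> (FV e' - pvars p)"
| "FV EUnit = {}"

definition FVa :: "exp \<Rightarrow> var set" where
  "FVa e = {v \<in> FV e. arrow_var v}"

definition FVl :: "lterm \<Rightarrow> var set" where
  "FVl l = FV (lexp l)"

fun bv_list :: "exp \<Rightarrow> var list" where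
  "bv_list (EVar v) = []"
| "bv_list (EVec Q m) = []"
| "bv_list (EMat P Q M p) = []"
| "bv_list (EApp f p) = []"
| "bv_list (EPair e e') = bv_list e @ bv_list e'"
| "bv_list (ELam p e) = pvar_list p @ bv_list e"
| "bv_list (ELet p e e') = pvar_list p @ bv_list e @ bv_list e'"
| "bv_list EUnit = []"

definition var_convention :: "exp \<Rightarrow> bool" where
  "var_convention e \<longleftrightarrow> distinct (bv_list e) \<and> set (bv_list e) \<inter> FV e = {}"

definition all_vars :: "lterm \<Rightarrow> var set" where
  "all_vars l = FVl l \<union> set (bv_list (lexp l))"

fun output_pat :: "lterm \<Rightarrow> pat" where
  "output_pat (Out p) = p"
| "output_pat (LLet p e l) = output_pat l"

fun defined_vars :: "lterm \<Rightarrow> var set" where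
  "defined_vars (Out p) = {}"
| "defined_vars (LLet p e l) = pvars p \<union> defined_vars l"


section \<open>Typing\<close>

definition prob_vector :: "ty \<Rightarrow> (elt \<Rightarrow> real) \<Rightarrow> bool" where
  "prob_vector Q m \<longleftrightarrow> (\<forall>b\<in>web Q. 0 \<le> m b) \<and> (\<Sum>b\<in>web Q. m b) = 1"

definition stochastic :: "ty \<Rightarrow> ty \<Rightarrow> (elt \<Rightarrow> elt \<Rightarrow> real) \<Rightarrow> bool" where
  "stochastic P Q M \<longleftrightarrow> (\<forall>a\<in>web P. prob_vector Q (M a))"

inductive wt :: "exp \<Rightarrow> ty \<Rightarrow> bool" where
  wt_var: "var_ok v \<Longrightarrow> wt (EVar v) (ty v)"
| wt_app: "\<lbrakk>var_ok f; ty f = Lolli P T; linear_pat p; pos_pat p; wt (pexp p) P\<rbrakk>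
     \<Longrightarrow> wt (EApp f p) T"
| wt_vec: "\<lbrakk>positive Q; prob_vector Q m\<rbrakk> \<Longrightarrow> wt (EVec Q m) Q"
| wt_mat: "\<lbrakk>positive P; positive Q; stochastic P Q M; linear_pat p; pos_pat p; wt (pexp p) P\<rbrakk>
     \<Longrightarrow> wt (EMat P Q M p) Q"
| wt_lam: "\<lbrakk>linear_pat p; pos_pat p; wt (pexp p) P; wt e T\<rbrakk> \<Longrightarrow> wt (ELam p e) (Lolli P T)"
| wt_pair: "\<lbrakk>wt e P; positive P; wt e' T; FVa e \<inter> FVa e' = {}\<rbrakk>
     \<Longrightarrow> wt (EPair e e') (Tens P T)"
| wt_let: "\<lbrakk>linear_pat p; wt (pexp p) T; wt e T; wt e' U; FVa e \<inter> FVa e' = {};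
      \<And>f. f \<in> pvars p \<Longrightarrow> arrow_var f \<Longrightarrow> f \<in> FVa e'\<rbrakk>
     \<Longrightarrow> wt (ELet p e e') U"

definition wt_lterm :: "lterm \<Rightarrow> ty \<Rightarrow> bool" where
  "wt_lterm l T \<longleftrightarrow> linear_pat (output_pat l) \<and> wt (lexp l) T"

definition pos_lterm :: "lterm \<Rightarrow> bool" where
  "pos_lterm l \<longleftrightarrow> pos_pat (output_pat l)"


section \<open>Semantics\<close>

abbreviation delta :: "elt \<Rightarrow> elt \<Rightarrow> real" where
  "delta a b \<equiv> of_bool (a = b)"

fun sem :: "exp \<Rightarrow> (var \<Rightarrow> elt) \<Rightarrow> elt \<Rightarrow> real" where
  "sem (EVar v) a b = delta (a v) b"
| "sem (EVec Q m) a b = m b"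
| "sem (EMat P Q M p) a b = M (pval p a) b"
| "sem (EApp f p) a b =
     (case a f of Pr a' a'' \<Rightarrow> delta a' (pval p a) * delta a'' b | _ \<Rightarrow> 0)"
| "sem (EPair e e') a b =
     (case b of Pr b' b'' \<Rightarrow> sem e (restrict a (FV e)) b' * sem e' (restrict a (FV e')) b''
      | _ \<Rightarrow> 0)"
| "sem (ELam p e) a b =
     (case b of Pr b' b'' \<Rightarrow> sem e (restrict (override_on a (pasg p b') (pvars p)) (FV e)) b''
      | _ \<Rightarrow> 0)"
| "sem (ELet p e e') a b =
     (\<Sum>c\<in>assigns (pvars p). sem e (restrict a (FV e)) (pval p c)
        * sem e' (restrict (override_on a c (pvars p)) (FV e')) b)"
| "sem EUnit a b = delta Star b"


section \<open>Factors\<close>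

text \<open>
  In all factors built below \<open>fval\<close> is extensional on \<open>assigns (fvars \<phi>)\<close>, so that equality
  of factors is equality of their variables and of their functions on \<open>|Var(\<phi>)|\<close>.  Collections
  of factors are multisets: a disjoint union may contain the same factor twice.
\<close>

datatype factor = Factor (fvars: "var set") (fval: "(var \<Rightarrow> elt) \<Rightarrow> real")

definition mk_factor :: "var set \<Rightarrow> ((var \<Rightarrow> elt) \<Rightarrow> real) \<Rightarrow> factor" where
  "mk_factor V \<phi> = Factor V (restrict \<phi> (assigns V))"

definition fsum :: "var set \<Rightarrow> factor \<Rightarrow> factor" where
  "fsum S \<phi> = mk_factor (fvars \<phi> - S)
     (\<lambda>a. \<Sum>b\<in>assigns (S \<inter> fvars \<phi>). fval \<phi> (override_on a b (S \<inter> fvars \<phi>)))"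

definition fprod :: "factor \<Rightarrow> factor \<Rightarrow> factor" where
  "fprod \<phi> \<psi> = mk_factor (fvars \<phi> \<union> fvars \<psi>)
     (\<lambda>c. fval \<phi> (restrict c (fvars \<phi>)) * fval \<psi> (restrict c (fvars \<psi>)))"

definition fprods :: "factor multiset \<Rightarrow> factor" where
  "fprods \<Gamma> = mk_factor (\<Union>\<phi>\<in>set_mset \<Gamma>. fvars \<phi>)
     (\<lambda>c. \<Prod>\<phi>\<in>#\<Gamma>. fval \<phi> (restrict c (fvars \<phi>)))"

lemma fprods_empty: "fprods {#} = mk_factor {} (\<lambda>_. 1)"
  by (simp add: fprods_def)

lemma fprods_add_mset: "fprods (add_mset \<phi> \<Gamma>) = fprod \<phi> (fprods \<Gamma>)"
proof -
  let ?V = "\<Union>\<psi>\<in>set_mset \<Gamma>. fvars \<psi>"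
  have res: "restrict c ?V \<in> assigns ?V" if "c \<in> assigns (fvars \<phi> \<union> ?V)" for c
    using that unfolding assigns_def PiE_def Pi_def extensional_def by auto
  have int: "?V \<inter> fvars \<psi> = fvars \<psi>" if "\<psi> \<in># \<Gamma>" for \<psi>
    using that by auto
  have "(\<Prod>\<psi>\<in>#\<Gamma>. fval \<psi> (restrict (restrict c ?V) (fvars \<psi>)))
      = (\<Prod>\<psi>\<in>#\<Gamma>. fval \<psi> (restrict c (fvars \<psi>)))" for c
    by (intro arg_cong[where f = prod_mset] image_mset_cong)
       (simp only: restrict_restrict int)
  then show ?thesis
    using res by (auto simp: fprods_def fprod_def mk_factor_def fun_eq_iff restrict_def)
qed

definition touching :: "factor multiset \<Rightarrow> var set \<Rightarrow> factor multiset" where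
  "touching \<Gamma> V = {# \<phi> \<in># \<Gamma>. fvars \<phi> \<inter> V \<noteq> {} #}"

definition avoiding :: "factor multiset \<Rightarrow> var set \<Rightarrow> factor multiset" where
  "avoiding \<Gamma> V = \<Gamma> - touching \<Gamma> V"

definition Fact :: "pat \<Rightarrow> exp \<Rightarrow> factor" where
  "Fact p e = mk_factor (FV e \<union> pvars p)
     (\<lambda>d. sem e (restrict d (FV e)) (pval p (restrict d (pvars p))))"

fun Facts :: "lterm \<Rightarrow> factor multiset" where
  "Facts (Out w) = {# mk_factor (pvars w) (\<lambda>_. 1) #}"
| "Facts (LLet p e l) =
     (case parrow p of
        Some f \<Rightarrow>
          if f \<notin> pvars (output_pat l)
          then {# fsum {f} (fprod (Fact p e) (fprods (touching (Facts l) {f}))) #}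
               + avoiding (Facts l) {f}
          else {# Fact p e #} + Facts l
      | None \<Rightarrow> {# Fact p e #} + Facts l)"

definition VE_F :: "factor multiset \<Rightarrow> var \<Rightarrow> factor multiset" where
  "VE_F \<Gamma> v = {# fsum {v} (fprods (touching \<Gamma> {v})) #} + avoiding \<Gamma> {v}"


section \<open>Variable elimination on let-terms\<close>

text \<open>
  \<open>SD\<close> and \<open>VA\<close> are applied to subterms, so freshness for the argument alone would not exclude
  capture by a later swap: the parameter \<open>A\<close> is the set of variables of the whole term.
\<close>

definition fresh :: "var set \<Rightarrow> ty \<Rightarrow> var" where
  "fresh A T = (SOME g. g \<notin> A \<and> ty g = T)"

lemma fresh: assumes "finite A" shows "fresh A T \<notin> A" and "ty (fresh A T) = T"
proof -
  have "infinite (range (\<lambda>n. Var n T))"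
    by (auto dest: finite_imageD simp: inj_on_def)
  then obtain g where "g \<in> range (\<lambda>n. Var n T)" "g \<notin> A"
    using assms by (meson finite_subset subsetI)
  then have "\<exists>g. g \<notin> A \<and> ty g = T" by auto
  from someI_ex[OF this] show "fresh A T \<notin> A" and "ty (fresh A T) = T"
    by (simp_all add: fresh_def)
qed

text \<open>
  In the last case the inner binder \<open>p1\<close> is not renamed apart from the outer one; \<open>FV\<close> and \<open>sem\<close>
  are lexically scoped, so this does not matter.  The same holds for \<open>VA\<close> and \<open>VE_L_aux\<close>.
\<close>

fun SD :: "var set \<Rightarrow> lterm \<Rightarrow> lterm" where
  "SD A (LLet p1 e1 (LLet p2 e2 l)) =
     (if pvars p1 \<inter> FV e2 = {} then LLet p2 e2 (LLet p1 e1 l)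
      else if \<forall>v \<in> pvars p1 \<inter> FV e2. pos_var v then
        (let xs = pfilter (\<lambda>v. v \<in> FV e2) p1;
             g = fresh (A \<union> all_vars (LLet p1 e1 (LLet p2 e2 l))) (Lolli (pty xs) (pty p2))
         in LLet (PVar g) (ELam xs e2) (LLet p1 e1 (LLet p2 (EApp g xs) l)))
      else LLet (ppair (ppos p1) p2) (ELet p1 e1 (epair (ppos p1) e2)) l)"
| "SD A l = l"

text \<open>
  If \<open>p1\<close> is positive and no variable of \<open>V\<close> is free in \<open>l\<close>, there is nothing to be gathered
  with the definition of \<open>p1\<close> and the term is returned unchanged.  Merging with the first
  definition of \<open>l\<close> regardless would identify two factors that have to remain distinct, as in
  eliminating \<open>x\<close> from \<open>(x = M; y = M'(x); z = M''(y) in z)\<close>, and \<open>l\<close> may contain no definition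
  at all.  In every other case the set passed to the recursive call is not empty.  The \<open>Out\<close> branches are never
  reached from a well-typed positive term.
\<close>

fun VA :: "var set \<Rightarrow> lterm \<Rightarrow> var set \<Rightarrow> lterm" where
  "VA A (Out w) V = Out w"
| "VA A (LLet p1 e1 l) V =
     (if V = {} then LLet p1 e1 l
      else if V \<inter> FV e1 = {} then SD A (LLet p1 e1 (VA A l V))
      else (case parrow p1 of
        None \<Rightarrow>
          if V \<inter> FVl l = {} then LLet p1 e1 l
          else (case VA A l (V \<inter> FVl l) of
              LLet p' e' l' \<Rightarrow> LLet (ppair p1 p') (ELet p1 e1 (epair p1 e')) l'
            | Out w \<Rightarrow> LLet p1 e1 l)
      | Some f \<Rightarrow>
          (case VA A l ((V \<inter> FVl l) \<union> {f}) of
              LLet p' e' l' \<Rightarrow>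
                LLet (ppair (ppos p1) p') (ELet p1 e1 (epair (ppos p1) e')) l'
            | Out w \<Rightarrow> LLet p1 e1 l)))"

fun VE_L_aux :: "var set \<Rightarrow> lterm \<Rightarrow> var \<Rightarrow> lterm" where
  "VE_L_aux A (Out w) x = Out w"
| "VE_L_aux A (LLet p1 e1 l) x =
     (if x \<in> pvars p1 then
        (let q = pdel x p1 in
         if x \<notin> FVl l then LLet q (ELet p1 e1 (pexp q)) l
         else (case parrow q of
           None \<Rightarrow>
             (case VA A l {x} of
                 LLet p' e' l' \<Rightarrow> LLet (ppair q p') (ELet p1 e1 (epair q e')) l'
               | Out w \<Rightarrow> LLet p1 e1 l)
         | Some f \<Rightarrow>
             (case VA A l {x, f} of
                 LLet p' e' l' \<Rightarrow>
                   LLet (ppair (ppos q) p') (ELet p1 e1 (epair (ppos q) e')) l'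
               | Out w \<Rightarrow> LLet p1 e1 l)))
      else SD A (LLet p1 e1 (VE_L_aux A l x)))"

definition VE_L :: "lterm \<Rightarrow> var \<Rightarrow> lterm" where
  "VE_L l x = VE_L_aux (all_vars l) l x"

end

theory Submission
  imports Defs
begin

text \<open>
  An operation \<open>elim W S\<close> on collections of factors multiplies the factors meeting \<open>W\<close> and sums
  out \<open>S \<subseteq> W\<close>.  Two such operations commute when neither sums over a variable the other looks at,
  and fuse into one, on the union of the two sets, when the first product meets the second set.
  \<open>Facts l\<close> arises from the factors of the definitions of \<open>l\<close> by eliminating the arrow variables.
  Hence swapping two definitions does not change the factors by commutation; abstracting a
  definition adds an arrow variable whose elimination restores the original factor; and merging
  two definitions multiplies their factors and sums out the variables dropped from the pattern.
  Consequently \<open>VA\<close> acts on the factors as \<open>elim V {}\<close>, with all factors meeting \<open>V\<close> collected in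
  the first definition, and merging that with the definition of \<open>x\<close> amounts to \<open>elim {x} {x}\<close>,
  fused with \<open>elim {f} {f}\<close> if an arrow variable \<open>f\<close> is defined together with \<open>x\<close>.
\<close>


section \<open>Factors\<close>

lemma finite_web: "finite (web T)"
proof (induction T)
  case (Tens P T)
  have "web (Tens P T) = (\<lambda>(a, b). Pr a b) ` (web P \<times> web T)" by auto
  with Tens show ?case by simp
next
  case (Lolli P T)
  have "web (Lolli P T) = (\<lambda>(a, b). Pr a b) ` (web P \<times> web T)" by auto
  with Lolli show ?case by simp
qed auto

lemma finite_assigns: "finite V \<Longrightarrow> finite (assigns V)"
  by (simp add: assigns_def finite_PiE finite_web)

lemma restrict_assigns: "a \<in> assigns V \<Longrightarrow> U \<subseteq> V \<Longrightarrow> restrict a U \<in> assigns U"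
  by (auto simp: assigns_def PiE_def Pi_def)

lemma override_assigns:
  "a \<in> assigns V \<Longrightarrow> b \<in> assigns U \<Longrightarrow> override_on a b U \<in> assigns (V \<union> U)"
  by (auto simp: assigns_def PiE_def Pi_def extensional_def override_on_def)

lemma assigns_empty: "assigns {} = {\<lambda>_. undefined}"
  by (simp add: assigns_def)

text \<open>Fubini: an assignment on a disjoint union is the same as the pair of its
  restrictions.\<close>

lemma sum_assigns_Un:
  assumes "S \<inter> T = {}" "finite S" "finite T"
  shows "(\<Sum>d\<in>assigns (S \<union> T). F d) = (\<Sum>b\<in>assigns S. \<Sum>c\<in>assigns T. F (override_on b c T))"
proof -
  have "(\<Sum>b\<in>assigns S. \<Sum>c\<in>assigns T. F (override_on b c T))
      = (\<Sum>(b, c)\<in>assigns S \<times> assigns T. F (override_on b c T))"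
    by (simp add: sum.cartesian_product)
  also have "\<dots> = (\<Sum>d\<in>assigns (S \<union> T). F d)"
    by (rule sum.reindex_bij_witness[where i = "\<lambda>d. (restrict d S, restrict d T)"
          and j = "\<lambda>(b, c). override_on b c T"])
      (use assms(1) in \<open>auto simp: assigns_def PiE_def Pi_def extensional_def override_on_def
        restrict_def fun_eq_iff disjoint_iff\<close>)
  finally show ?thesis by simp
qed

section \<open>Variables, values and algebraic laws of factors\<close>

lemma fvars_mk_factor [simp]: "fvars (mk_factor V \<phi>) = V"
  by (simp add: mk_factor_def)

lemma fval_mk_factor: "a \<in> assigns V \<Longrightarrow> fval (mk_factor V \<phi>) a = \<phi> a"
  by (simp add: mk_factor_def)

lemma mk_factor_cong:
  "V = V' \<Longrightarrow> (\<And>a. a \<in> assigns V' \<Longrightarrow> \<phi> a = \<psi> a) \<Longrightarrow> mk_factor V \<phi> = mk_factor V' \<psi>"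
  by (auto simp: mk_factor_def restrict_def)

definition mvars :: "factor multiset \<Rightarrow> var set" where
  "mvars \<Gamma> = (\<Union>\<phi>\<in>set_mset \<Gamma>. fvars \<phi>)"

lemma mvars_simps [simp]:
  "mvars {#} = {}"
  "mvars (add_mset \<phi> \<Gamma>) = fvars \<phi> \<union> mvars \<Gamma>"
  "mvars (\<Gamma> + \<Delta>) = mvars \<Gamma> \<union> mvars \<Delta>"
  by (auto simp: mvars_def)

lemma fvars_fsum [simp]: "fvars (fsum S \<phi>) = fvars \<phi> - S"
  by (simp add: fsum_def)

lemma fvars_fprod [simp]: "fvars (fprod \<phi> \<psi>) = fvars \<phi> \<union> fvars \<psi>"
  by (simp add: fprod_def)

lemma fvars_fprods [simp]: "fvars (fprods \<Gamma>) = mvars \<Gamma>"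
  by (simp add: fprods_def mvars_def)

lemma fval_fprods:
  "c \<in> assigns (mvars \<Gamma>) \<Longrightarrow> fval (fprods \<Gamma>) c = (\<Prod>\<phi>\<in>#\<Gamma>. fval \<phi> (restrict c (fvars \<phi>)))"
  by (simp add: fprods_def fval_mk_factor mvars_def)

lemma fval_fsum:
  "a \<in> assigns (fvars \<phi> - S) \<Longrightarrow> fval (fsum S \<phi>) a
     = (\<Sum>b\<in>assigns (S \<inter> fvars \<phi>). fval \<phi> (override_on a b (S \<inter> fvars \<phi>)))"
  by (simp add: fsum_def fval_mk_factor)

text \<open>Variables in both \<open>S\<close> and \<open>T\<close> are summed only once: the inner
  sum removes them, so the outer one ranges over a set disjoint from \<open>T\<close>.\<close>

lemma fsum_fsum:
  assumes "finite S" "finite T"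
  shows "fsum S (fsum T \<phi>) = fsum (S \<union> T) \<phi>"
proof -
  let ?S = "S \<inter> (fvars \<phi> - T)" and ?T = "T \<inter> fvars \<phi>"
  have U: "(S \<union> T) \<inter> fvars \<phi> = ?S \<union> ?T" by auto
  have "(\<Sum>b\<in>assigns ?S. fval (fsum T \<phi>) (override_on a b ?S))
      = (\<Sum>b\<in>assigns ((S \<union> T) \<inter> fvars \<phi>). fval \<phi> (override_on a b ((S \<union> T) \<inter> fvars \<phi>)))"
    if a: "a \<in> assigns (fvars \<phi> - (S \<union> T))" for a
  proof -
    have "override_on a b ?S \<in> assigns (fvars \<phi> - T)" if "b \<in> assigns ?S" for b
    proof -
      have "fvars \<phi> - (S \<union> T) \<union> ?S = fvars \<phi> - T" by auto
      with override_assigns[OF a that] show ?thesis by simp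
    qed
    then have "(\<Sum>b\<in>assigns ?S. fval (fsum T \<phi>) (override_on a b ?S))
      = (\<Sum>b\<in>assigns ?S. \<Sum>c\<in>assigns ?T. fval \<phi> (override_on (override_on a b ?S) c ?T))"
      by (simp add: fval_fsum)
    also have "\<dots> = (\<Sum>b\<in>assigns ?S. \<Sum>c\<in>assigns ?T.
        fval \<phi> (override_on a (override_on b c ?T) (?S \<union> ?T)))"
      by (intro sum.cong refl arg_cong[where f = "fval \<phi>"]) (auto simp: override_on_def fun_eq_iff)
    also have "\<dots> = (\<Sum>d\<in>assigns (?S \<union> ?T). fval \<phi> (override_on a d (?S \<union> ?T)))"
      by (rule sum_assigns_Un[symmetric]) (use assms in auto)
    finally show ?thesis by (simp only: U)
  qed
  then show ?thesis
    by (subst (1 3) fsum_def) (auto intro!: mk_factor_cong)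
qed

text \<open>Distributivity: no factor of \<open>\<Gamma>\<close> depends on \<open>S\<close>, so
  their product may be moved under the sum.\<close>

lemma fprods_fsum:
  assumes "S \<inter> mvars \<Gamma> = {}"
  shows "fprods (add_mset (fsum S (fprods \<Delta>)) \<Gamma>) = fsum S (fprods (\<Delta> + \<Gamma>))"
proof -
  let ?D = "mvars \<Delta>" and ?G = "mvars \<Gamma>"
  let ?S = "S \<inter> ?D"
  let ?P = "\<lambda>\<Theta> c. \<Prod>\<phi>\<in>#\<Theta>. fval \<phi> (restrict c (fvars \<phi>))"
  have S: "S \<inter> (?D \<union> ?G) = ?S" using assms by auto
  \<comment> \<open>A product depends only on the variables of its factors; in particular, values on
    \<open>S\<close> are invisible to \<open>\<Gamma>\<close>.\<close>
  have cong: "?P \<Theta> c = ?P \<Theta> d" if "\<And>v. v \<in> mvars \<Theta> \<Longrightarrow> c v = d v" for \<Theta> c d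
  proof (intro arg_cong[where f = prod_mset] image_mset_cong)
    fix \<phi> assume "\<phi> \<in># \<Theta>"
    then have "restrict c (fvars \<phi>) = restrict d (fvars \<phi>)"
      using that by (auto simp: mvars_def restrict_def fun_eq_iff)
    then show "fval \<phi> (restrict c (fvars \<phi>)) = fval \<phi> (restrict d (fvars \<phi>))" by simp
  qed
  have "fval (fsum S (fprods \<Delta>)) (restrict c (?D - S)) * ?P \<Gamma> c
      = (\<Sum>b\<in>assigns ?S. fval (fprods (\<Delta> + \<Gamma>)) (override_on c b ?S))"
    if c: "c \<in> assigns (?D \<union> ?G - S)" for c
  proof -
    have rc: "restrict c (?D - S) \<in> assigns (?D - S)"
      by (rule restrict_assigns[OF c]) auto
    have 1: "fval (fprods \<Delta>) (override_on (restrict c (?D - S)) b ?S) = ?P \<Delta> (override_on c b ?S)"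
      if "b \<in> assigns ?S" for b
    proof -
      have "override_on (restrict c (?D - S)) b ?S \<in> assigns (?D - S \<union> ?S)"
        by (rule override_assigns[OF rc that])
      also have "?D - S \<union> ?S = ?D" by auto
      finally have "fval (fprods \<Delta>) (override_on (restrict c (?D - S)) b ?S)
          = ?P \<Delta> (override_on (restrict c (?D - S)) b ?S)"
        by (rule fval_fprods)
      also have "\<dots> = ?P \<Delta> (override_on c b ?S)"
        by (rule cong) (auto simp: override_on_def)
      finally show ?thesis .
    qed
    have 2: "fval (fprods (\<Delta> + \<Gamma>)) (override_on c b ?S)
        = ?P \<Delta> (override_on c b ?S) * ?P \<Gamma> c"
      if "b \<in> assigns ?S" for b
    proof -
      have "override_on c b ?S \<in> assigns (?D \<union> ?G - S \<union> ?S)"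
        by (rule override_assigns[OF c that])
      also have "?D \<union> ?G - S \<union> ?S = ?D \<union> ?G" using assms by auto
      finally have "fval (fprods (\<Delta> + \<Gamma>)) (override_on c b ?S)
          = ?P \<Delta> (override_on c b ?S) * ?P \<Gamma> (override_on c b ?S)"
        by (simp add: fval_fprods)
      also have "?P \<Gamma> (override_on c b ?S) = ?P \<Gamma> c"
        by (rule cong) (use assms in \<open>auto simp: override_on_def\<close>)
      finally show ?thesis .
    qed
    show ?thesis
      using rc by (simp add: fval_fsum sum_distrib_right 1 2)
  qed
  moreover have "?D - S \<union> ?G = ?D \<union> ?G - S" using assms by auto
  ultimately show ?thesis
    by (subst (2) fsum_def, subst fprods_def)
      (auto intro!: mk_factor_cong simp: S mvars_def[symmetric])
qed

text \<open>Stated for products because their functions are extensional, like those that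
  \<open>fsum\<close> returns.\<close>

lemma fsum_empty: "fsum {} (fprods \<Gamma>) = fprods \<Gamma>"
  unfolding fsum_def fvars_fprods
  by (subst fprods_def)
    (auto intro!: mk_factor_cong simp: assigns_empty fval_fprods mvars_def[symmetric])

lemma fprods_fprods: "fprods (add_mset (fprods \<Delta>) \<Gamma>) = fprods (\<Delta> + \<Gamma>)"
  using fprods_fsum[of "{}" \<Gamma> \<Delta>] by (simp add: fsum_empty)

lemma fprods_single: "fprods {#mk_factor V \<phi>#} = mk_factor V \<phi>"
  by (auto simp: fprods_def fval_mk_factor intro!: mk_factor_cong)
    (auto simp: assigns_def fval_mk_factor)

section \<open>Elimination\<close>

lemma avoiding_filter: "avoiding \<Gamma> W = {# \<phi> \<in># \<Gamma>. fvars \<phi> \<inter> W = {} #}"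
  unfolding avoiding_def touching_def
  using multiset_partition[of \<Gamma> "\<lambda>\<phi>. fvars \<phi> \<inter> W \<noteq> {}"]
  by (metis (no_types, lifting) add_diff_cancel_left' filter_mset_cong0)

text \<open>With \<open>S = W = {v}\<close> this is \<^const>\<open>VE_F\<close>; with \<open>S = {}\<close> the factors meeting \<open>W\<close> are
  multiplied without any summation.\<close>

definition elim :: "var set \<Rightarrow> var set \<Rightarrow> factor multiset \<Rightarrow> factor multiset" where
  "elim W S \<Gamma> = add_mset (fsum S (fprods (touching \<Gamma> W))) (avoiding \<Gamma> W)"

lemma VE_F_elim: "VE_F \<Gamma> v = elim {v} {v} \<Gamma>"
  by (simp add: VE_F_def elim_def)

section \<open>Factors meeting or avoiding a set, and composition of eliminations\<close>

lemma touching_simps [simp]: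
  "touching {#} W = {#}"
  "touching (add_mset \<phi> \<Gamma>) W = (if fvars \<phi> \<inter> W = {} then touching \<Gamma> W else add_mset \<phi> (touching \<Gamma> W))"
  by (simp_all add: touching_def)

lemma avoiding_simps [simp]:
  "avoiding {#} W = {#}"
  "avoiding (add_mset \<phi> \<Gamma>) W = (if fvars \<phi> \<inter> W = {} then add_mset \<phi> (avoiding \<Gamma> W) else avoiding \<Gamma> W)"
  by (simp_all add: avoiding_filter)

lemma touching_disjoint: "mvars \<Gamma> \<inter> W = {} \<Longrightarrow> touching \<Gamma> W = {#}"
  by (induction \<Gamma>) auto

lemma avoiding_disjoint: "mvars \<Gamma> \<inter> W = {} \<Longrightarrow> avoiding \<Gamma> W = \<Gamma>"
  by (induction \<Gamma>) auto

lemma mvars_touching_avoiding: "mvars (touching \<Gamma> W) \<union> mvars (avoiding \<Gamma> W) = mvars \<Gamma>"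
  by (induction \<Gamma>) auto

lemma mvars_avoiding: "mvars (avoiding \<Gamma> W) \<inter> W = {}"
  by (induction \<Gamma>) auto

lemma touching_Un: "touching \<Gamma> (V \<union> W) = touching \<Gamma> V + touching (avoiding \<Gamma> V) W"
  by (induction \<Gamma>) auto

lemma avoiding_Un: "avoiding \<Gamma> (V \<union> W) = avoiding (avoiding \<Gamma> V) W"
  by (induction \<Gamma>) auto

lemma mvars_elim: "S \<subseteq> W \<Longrightarrow> mvars (elim W S \<Gamma>) = mvars \<Gamma> - S"
  using mvars_touching_avoiding[of \<Gamma> W] mvars_avoiding[of \<Gamma> W] by (auto simp: elim_def)

lemma elim_add_disjoint: "fvars \<phi> \<inter> W = {} \<Longrightarrow> elim W S (add_mset \<phi> \<Gamma>) = add_mset \<phi> (elim W S \<Gamma>)"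
  by (simp add: elim_def)

text \<open>The product formed by the first elimination still meets \<open>W\<close>, so the second
  absorbs it. As \<open>S \<subseteq> V\<close>, no factor avoiding \<open>V\<close> contains a
  variable of \<open>S\<close>, and distributivity puts both sums over one product.\<close>

lemma elim_elim_linked:
  assumes "finite S" "finite S'" "S \<subseteq> V" "W \<inter> (mvars (touching \<Gamma> V) - S) \<noteq> {}"
  shows "elim W S' (elim V S \<Gamma>) = elim (V \<union> W) (S' \<union> S) \<Gamma>"
proof -
  have "S \<inter> mvars (touching (avoiding \<Gamma> V) W) = {}"
    using assms(3) mvars_avoiding[of \<Gamma> V] mvars_touching_avoiding[of "avoiding \<Gamma> V" W] by auto
  then show ?thesis
    using assms by (simp add: elim_def fprods_fsum fsum_fsum touching_Un avoiding_Un Int_commute)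
qed

text \<open>The product formed first does not meet \<open>W\<close> and passes through the second
  elimination unchanged.\<close>

lemma elim_elim_unlinked:
  assumes "W \<inter> (mvars (touching \<Gamma> V) - S) = {}"
  shows "elim W S' (elim V S \<Gamma>) = add_mset (fsum S (fprods (touching \<Gamma> V)))
     (add_mset (fsum S' (fprods (touching (avoiding \<Gamma> V) W))) (avoiding \<Gamma> (V \<union> W)))"
  using assms by (simp add: elim_def avoiding_Un Int_commute)

lemma touching_avoiding_unlinked:
  "W \<inter> mvars (touching \<Gamma> V) = {} \<Longrightarrow> touching (avoiding \<Gamma> V) W = touching \<Gamma> W"
  by (induction \<Gamma>) (auto split: if_splits)

text \<open>Either side says that some single factor meets both sets.\<close>

lemma linked_sym: "W \<inter> mvars (touching \<Gamma> V) \<noteq> {} \<longleftrightarrow> V \<inter> mvars (touching \<Gamma> W) \<noteq> {}"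
  by (auto simp: mvars_def touching_def)

text \<open>If some factor meets both sets, both orders fuse to the same elimination on
  \<open>V \<union> W\<close>; otherwise they act on disjoint subcollections. The conditions on
  \<open>S\<close> and \<open>S'\<close> ensure that summing does not destroy the link.\<close>

lemma elim_commute:
  assumes "finite S" "finite S'" "S \<subseteq> V" "S' \<subseteq> W" "S \<inter> W = {}" "S' \<inter> V = {}"
  shows "elim W S' (elim V S \<Gamma>) = elim V S (elim W S' \<Gamma>)"
proof -
  have *: "W \<inter> (X - S) = W \<inter> X" "V \<inter> (X - S') = V \<inter> X" for X
    using assms by auto
  show ?thesis
  proof (cases "W \<inter> mvars (touching \<Gamma> V) = {}")
    case True
    then have "V \<inter> mvars (touching \<Gamma> W) = {}" using linked_sym by blast
    with True show ?thesis
      by (simp add: elim_elim_unlinked * touching_avoiding_unlinked Un_commute add_mset_commute)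
  next
    case False
    then have "V \<inter> mvars (touching \<Gamma> W) \<noteq> {}" using linked_sym by blast
    with False assms show ?thesis
      by (simp add: elim_elim_linked * Un_commute)
  qed
qed

text \<open>Factors already multiplied together by \<open>elim U {}\<close> are collected again by
  \<open>elim W S\<close>. If \<open>U\<close> were disjoint from \<open>mvars \<Gamma>\<close>, the
  inner elimination would leave behind the empty product, a factor without variables that the outer
  one cannot absorb.\<close>

lemma elim_add_elim:
  assumes "touching \<Gamma> U = touching \<Gamma> W" "U \<inter> mvars \<Gamma> \<noteq> {}" "U \<subseteq> W"
  shows "elim W S (add_mset \<phi> (elim U {} \<Gamma>)) = elim W S (add_mset \<phi> \<Gamma>)"
proof -
  have a: "avoiding \<Gamma> U = avoiding \<Gamma> W" by (simp add: avoiding_def assms(1))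
  have t: "touching (avoiding \<Gamma> W) W = {#}" "avoiding (avoiding \<Gamma> W) W = avoiding \<Gamma> W"
    by (rule touching_disjoint avoiding_disjoint, rule mvars_avoiding)+
  have "mvars (touching \<Gamma> W) \<inter> W \<noteq> {}"
    using assms(2,3) mvars_touching_avoiding[of \<Gamma> W] mvars_avoiding[of \<Gamma> W] by auto
  then show ?thesis
    using fprods_fprods[of "touching \<Gamma> W" "{#}"] fprods_fprods[of "touching \<Gamma> W" "{#\<phi>#}"]
    by (simp add: elim_def fsum_empty assms(1) a t add_mset_commute[of _ \<phi>])
qed


section \<open>Semantics of patterns\<close>

lemma pvars_simps [simp]:
  "pvars (PVar v) = {v}" "pvars (PPair p q) = pvars p \<union> pvars q" "pvars PUnit = {}"
  by (simp_all add: pvars_def)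

lemma finite_pvars [simp]: "finite (pvars p)"
  by (simp add: pvars_def)

lemma FV_pexp [simp]: "FV (pexp p) = pvars p"
  by (induction p) auto

lemma pvars_pfilter [simp]: "pvars (pfilter R p) = {v \<in> pvars p. R v}"
  by (induction p) auto

lemma pvars_ppair [simp]: "pvars (ppair p q) = pvars p \<union> pvars q"
  by (simp add: ppair_def)

lemma FV_epair [simp]: "FV (epair p e) = pvars p \<union> FV e"
  by (simp add: epair_def)

lemma pval_eq_iff: "pval p a = pval p b \<longleftrightarrow> (\<forall>v\<in>pvars p. a v = b v)"
  by (induction p) auto

lemma pval_web: "a \<in> assigns V \<Longrightarrow> pvars p \<subseteq> V \<Longrightarrow> pval p a \<in> web (pty p)"
  by (induction p) (auto simp: assigns_def)

lemma pasg_pval: "a \<in> assigns V \<Longrightarrow> pvars p \<subseteq> V \<Longrightarrow> pasg p (pval p a) = restrict a (pvars p)"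
proof -
  assume a: "a \<in> assigns V" "pvars p \<subseteq> V"
  have "inj_on (pval p) (assigns (pvars p))"
    by (rule inj_onI) (auto simp: pval_eq_iff assigns_def PiE_def extensional_def fun_eq_iff)
  then have "pasg p (pval p (restrict a (pvars p))) = restrict a (pvars p)"
    unfolding pasg_def by (rule inv_into_f_f) (rule restrict_assigns[OF a])
  moreover have "pval p (restrict a (pvars p)) = pval p a"
    by (simp add: pval_eq_iff)
  ultimately show ?thesis by simp
qed

text \<open>A pattern read as an expression denotes the identity matrix on its variables.\<close>

lemma sem_pexp: "sem (pexp p) a (pval p d) = of_bool (\<forall>v\<in>pvars p. a v = d v)"
  by (induction p arbitrary: a) (auto simp: restrict_def)

text \<open>Extensionality of \<open>a\<close> matters when \<open>q\<close> is empty: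
  \<open>EPair\<close> restricts the assignment for each component, whereas \<open>e\<close> alone
  receives \<open>a\<close> itself.\<close>

lemma sem_epair:
  "sem (epair q e) a (pval (ppair q p) d)
     = of_bool (\<forall>v\<in>pvars q. a v = d v) * sem e (restrict a (FV e)) (pval p d)"
  if "a = restrict a (pvars q \<union> FV e)"
proof (cases "q = PUnit")
  case True
  then have "restrict a (FV e) = a" using that by simp
  with True show ?thesis by (simp add: epair_def ppair_def)
next
  case False
  then show ?thesis by (simp add: epair_def ppair_def sem_pexp)
qed

text \<open>The indicator leaves the \<open>c\<close> that agree with \<open>d\<close> on
  \<open>Q\<close>, and these are determined by their values on \<open>P - Q\<close>.\<close>

lemma sum_assigns_matching:
  assumes "Q \<subseteq> P" "finite P" "d \<in> assigns V" "Q \<subseteq> V"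
  shows "(\<Sum>c\<in>assigns P. of_bool (\<forall>v\<in>Q. c v = d v) * F c)
    = (\<Sum>b\<in>assigns (P - Q). F (override_on (restrict d Q) b (P - Q)) :: real)"
proof -
  have 1: "(\<Sum>c\<in>assigns P. of_bool (\<forall>v\<in>Q. c v = d v) * F c)
      = (\<Sum>c\<in>{c \<in> assigns P. \<forall>v\<in>Q. c v = d v}. F c)"
    using assms(2) by (auto intro!: sum.mono_neutral_cong_right simp: finite_assigns)
  have *: "override_on (restrict d Q) (restrict c (P - Q)) (P - Q) = c"
    if "c \<in> assigns P" "\<forall>v\<in>Q. c v = d v" for c
    using that assms by (auto simp: assigns_def PiE_def extensional_def override_on_def fun_eq_iff)
  have "(\<Sum>c\<in>{c \<in> assigns P. \<forall>v\<in>Q. c v = d v}. F c)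
      = (\<Sum>b\<in>assigns (P - Q). F (override_on (restrict d Q) b (P - Q)))"
    by (rule sum.reindex_bij_witness[where j = "\<lambda>c. restrict c (P - Q)"
          and i = "\<lambda>b. override_on (restrict d Q) b (P - Q)"])
      (use assms * in \<open>auto simp: assigns_def PiE_def Pi_def extensional_def override_on_def
        restrict_def fun_eq_iff\<close>)
  with 1 show ?thesis by simp
qed

section \<open>Factors of definitions\<close>

lemma fvars_Fact [simp]: "fvars (Fact p e) = FV e \<union> pvars p"
  by (simp add: Fact_def)

lemma pval_restrict [simp]: "pval p (restrict d (pvars p)) = pval p d"
  by (simp add: pval_eq_iff)

lemma fval_Fact: "d \<in> assigns (FV e \<union> pvars p) \<Longrightarrow> fval (Fact p e) d = sem e (restrict d (FV e)) (pval p d)"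
  by (simp add: Fact_def fval_mk_factor)

lemma fval_fprod_Fact:
  assumes "d \<in> assigns V" "V = FV e \<union> pvars p \<union> (FV e' \<union> pvars p')"
  shows "fval (fprod (Fact p e) (Fact p' e')) d
    = sem e (restrict d (FV e)) (pval p d) * sem e' (restrict d (FV e')) (pval p' d)"
proof -
  have "restrict d (FV e \<union> pvars p) \<in> assigns (FV e \<union> pvars p)"
       "restrict d (FV e' \<union> pvars p') \<in> assigns (FV e' \<union> pvars p')"
    by (rule restrict_assigns[OF assms(1)], use assms(2) in auto)+
  moreover have "pval p (restrict d (FV e \<union> pvars p)) = pval p d"
    "pval p' (restrict d (FV e' \<union> pvars p')) = pval p' d"
    by (simp_all add: pval_eq_iff)
  ultimately show ?thesis
    using assms by (simp add: fprod_def fval_mk_factor fval_Fact Int_absorb1)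
qed

text \<open>A summand of the let expression survives only if its values for \<open>q\<close> agree
  with \<open>d\<close>, which leaves a sum over the variables of \<open>p\<close> missing from
  \<open>q\<close>. By the disjointness hypotheses these variables affect neither the inputs of
  \<open>e\<close> nor the value of \<open>p'\<close>.\<close>

lemma Fact_merge:
  assumes "pvars q \<subseteq> pvars p" "pvars p \<inter> FV e = {}" "(pvars p - pvars q) \<inter> pvars p' = {}"
  shows "Fact (ppair q p') (ELet p e (epair q e'))
    = fsum (pvars p - pvars q) (fprod (Fact p e) (Fact p' e'))"
proof -
  let ?P = "pvars p" and ?Q = "pvars q"
  let ?L = "FV (ELet p e (epair q e'))"
  let ?V = "FV e \<union> ?P \<union> (FV e' \<union> pvars p')"
  let ?c = "\<lambda>d b. override_on (restrict d ?Q) b (?P - ?Q)"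
  have V: "?L \<union> pvars (ppair q p') = ?V - (?P - ?Q)"
    using assms by auto
  have S: "(?P - ?Q) \<inter> ?V = ?P - ?Q" by auto
  have "sem (ELet p e (epair q e')) (restrict d ?L) (pval (ppair q p') d)
      = (\<Sum>b\<in>assigns (?P - ?Q).
          fval (fprod (Fact p e) (Fact p' e')) (override_on d b (?P - ?Q)))"
    if d: "d \<in> assigns (?V - (?P - ?Q))" for d
  proof -
    have 1: "sem (epair q e') (restrict (override_on (restrict d ?L) c ?P) (FV (epair q e')))
          (pval (ppair q p') d)
        = of_bool (\<forall>v\<in>?Q. c v = d v)
          * sem e' (restrict (override_on d c ?P) (FV e')) (pval p' d)" for c
    proof -
      let ?a = "restrict (override_on (restrict d ?L) c ?P) (FV (epair q e'))"
      have "(\<forall>v\<in>?Q. ?a v = d v) \<longleftrightarrow> (\<forall>v\<in>?Q. c v = d v)"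
        using assms(1) by (auto simp: override_on_def)
      moreover have "restrict ?a (FV e') = restrict (override_on d c ?P) (FV e')"
        by (auto simp: override_on_def restrict_def fun_eq_iff)
      ultimately show ?thesis
        by (subst sem_epair) auto
    qed
    have 2: "restrict (restrict d ?L) (FV e) = restrict d (FV e)"
      by (auto simp: restrict_def fun_eq_iff)
    have "sem (ELet p e (epair q e')) (restrict d ?L) (pval (ppair q p') d)
        = (\<Sum>c\<in>assigns ?P. of_bool (\<forall>v\<in>?Q. c v = d v) * (sem e (restrict d (FV e)) (pval p c)
            * sem e' (restrict (override_on d c ?P) (FV e')) (pval p' d)))"
      by (simp only: sem.simps 1 2 mult.left_commute)
    also have "\<dots> = (\<Sum>b\<in>assigns (?P - ?Q). sem e (restrict d (FV e)) (pval p (?c d b))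
            * sem e' (restrict (override_on d (?c d b) ?P) (FV e')) (pval p' d))"
      by (rule sum_assigns_matching[OF assms(1) finite_pvars d]) (use assms(1) in auto)
    also have "\<dots> = (\<Sum>b\<in>assigns (?P - ?Q).
          fval (fprod (Fact p e) (Fact p' e')) (override_on d b (?P - ?Q)))"
    proof (rule sum.cong[OF refl])
      fix b assume b: "b \<in> assigns (?P - ?Q)"
      let ?d = "override_on d b (?P - ?Q)"
      have "?d \<in> assigns (?V - (?P - ?Q) \<union> (?P - ?Q))"
        by (rule override_assigns[OF d b])
      also have "?V - (?P - ?Q) \<union> (?P - ?Q) = ?V" by auto
      finally have "fval (fprod (Fact p e) (Fact p' e')) ?d
          = sem e (restrict ?d (FV e)) (pval p ?d) * sem e' (restrict ?d (FV e')) (pval p' ?d)"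
        by (rule fval_fprod_Fact) simp
      moreover have "pval p ?d = pval p (?c d b)" "pval p' ?d = pval p' d"
        using assms(3) by (auto simp: pval_eq_iff override_on_def)
      moreover have "restrict ?d (FV e) = restrict d (FV e)"
        using assms(2) by (auto simp: override_on_def restrict_def fun_eq_iff)
      moreover have "restrict ?d (FV e') = restrict (override_on d (?c d b) ?P) (FV e')"
        using assms(1) by (auto simp: override_on_def restrict_def fun_eq_iff)
      ultimately show "sem e (restrict d (FV e)) (pval p (?c d b))
            * sem e' (restrict (override_on d (?c d b) ?P) (FV e')) (pval p' d)
          = fval (fprod (Fact p e) (Fact p' e')) ?d"
        by simp
    qed
    finally show ?thesis .
  qed
  moreover have "pval (ppair q p') (restrict d (pvars (ppair q p'))) = pval (ppair q p') d" for d
    by (rule pval_restrict)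
  ultimately show ?thesis
    unfolding Fact_def[of "ppair q p'"] fsum_def fvars_fprod fvars_Fact S
    by (intro mk_factor_cong V) (simp only:)
qed

text \<open>The degenerate merge: the body only returns \<open>q\<close> and contributes nothing but
  the indicator.\<close>

lemma Fact_drop:
  assumes "pvars q \<subseteq> pvars p" "pvars p \<inter> FV e = {}"
  shows "Fact q (ELet p e (pexp q)) = fsum (pvars p - pvars q) (Fact p e)"
proof -
  let ?P = "pvars p" and ?Q = "pvars q"
  let ?L = "FV (ELet p e (pexp q))"
  let ?V = "FV e \<union> ?P"
  let ?c = "\<lambda>d b. override_on (restrict d ?Q) b (?P - ?Q)"
  have V: "?L \<union> ?Q = ?V - (?P - ?Q)"
    using assms by auto
  have S: "(?P - ?Q) \<inter> ?V = ?P - ?Q" by auto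
  have "sem (ELet p e (pexp q)) (restrict d ?L) (pval q d)
      = (\<Sum>b\<in>assigns (?P - ?Q). fval (Fact p e) (override_on d b (?P - ?Q)))"
    if d: "d \<in> assigns (?V - (?P - ?Q))" for d
  proof -
    have 1: "sem (pexp q) (restrict (override_on (restrict d ?L) c ?P) (FV (pexp q))) (pval q d)
        = of_bool (\<forall>v\<in>?Q. c v = d v)" for c
      using assms(1) by (subst sem_pexp) (auto simp: override_on_def)
    have 2: "restrict (restrict d ?L) (FV e) = restrict d (FV e)"
      by (auto simp: restrict_def fun_eq_iff)
    have "sem (ELet p e (pexp q)) (restrict d ?L) (pval q d)
        = (\<Sum>c\<in>assigns ?P. of_bool (\<forall>v\<in>?Q. c v = d v) * sem e (restrict d (FV e)) (pval p c))"
      by (simp only: sem.simps 1 2 mult.commute)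
    also have "\<dots> = (\<Sum>b\<in>assigns (?P - ?Q). sem e (restrict d (FV e)) (pval p (?c d b)))"
      by (rule sum_assigns_matching[OF assms(1) finite_pvars d]) (use assms(1) in auto)
    also have "\<dots> = (\<Sum>b\<in>assigns (?P - ?Q). fval (Fact p e) (override_on d b (?P - ?Q)))"
    proof (rule sum.cong[OF refl])
      fix b assume b: "b \<in> assigns (?P - ?Q)"
      let ?d = "override_on d b (?P - ?Q)"
      have "?d \<in> assigns (?V - (?P - ?Q) \<union> (?P - ?Q))"
        by (rule override_assigns[OF d b])
      also have "?V - (?P - ?Q) \<union> (?P - ?Q) = ?V" by auto
      finally have "fval (Fact p e) ?d = sem e (restrict ?d (FV e)) (pval p ?d)"
        by (rule fval_Fact)
      moreover have "pval p ?d = pval p (?c d b)"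
        by (auto simp: pval_eq_iff override_on_def)
      moreover have "restrict ?d (FV e) = restrict d (FV e)"
        using assms(2) by (auto simp: override_on_def restrict_def fun_eq_iff)
      ultimately show "sem e (restrict d (FV e)) (pval p (?c d b)) = fval (Fact p e) ?d"
        by simp
    qed
    finally show ?thesis .
  qed
  then show ?thesis
    unfolding Fact_def[of q] fsum_def fvars_Fact S pval_restrict
    by (intro mk_factor_cong V) (simp only:)
qed

lemma sum_assigns_single:
  "(\<Sum>b\<in>assigns {g}. F b) = (\<Sum>t\<in>web (ty g). F ((\<lambda>_. undefined)(g := t)))"
proof -
  have "(\<lambda>_. undefined)(g := b g) = b" if "b \<in> assigns {g}" for b
    using that by (auto simp: assigns_def PiE_def extensional_def)
  then show ?thesis
    by (intro sum.reindex_bij_witness[where i = "\<lambda>t. (\<lambda>_. undefined)(g := t)" and j = "\<lambda>b. b g"])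
      (auto simp: assigns_def PiE_def extensional_def)
qed

text \<open>A value of \<open>g\<close> is a pair of an argument and a result. The two deltas of the
  application single out the pair given by the current values of \<open>xs\<close> and
  \<open>p\<close>, and on that pair the abstraction has the value of \<open>e\<close>.\<close>

lemma Fact_abstract:
  assumes "ty g = Lolli (pty xs) (pty p)" "pvars xs \<subseteq> FV e" "g \<notin> FV e" "g \<notin> pvars p"
  shows "fsum {g} (fprod (Fact (PVar g) (ELam xs e)) (Fact p (EApp g xs))) = Fact p e"
proof -
  let ?V = "FV e \<union> pvars p"
  let ?W = "FV (ELam xs e) \<union> pvars (PVar g) \<union> (FV (EApp g xs) \<union> pvars p)"
  have V: "?W - {g} = ?V"
    using assms by auto
  have S: "{g} \<inter> ?W = {g}" by auto
  have gx: "g \<notin> pvars xs" using assms by auto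
  have "(\<Sum>b\<in>assigns {g}. fval (fprod (Fact (PVar g) (ELam xs e)) (Fact p (EApp g xs)))
      (override_on d b {g})) = sem e (restrict d (FV e)) (pval p d)"
    if d: "d \<in> assigns ?V" for d
  proof -
    let ?t = "Pr (pval xs d) (pval p d)"
    let ?d = "\<lambda>t. d(g := t)"
    have web: "pval xs d \<in> web (pty xs)" "pval p d \<in> web (pty p)"
      by (rule pval_web[OF d], use assms(2) in auto)+
    have pa: "pasg xs (pval xs d) = restrict d (pvars xs)"
      by (rule pasg_pval[OF d]) (use assms(2) in auto)
    have "(\<Sum>b\<in>assigns {g}. fval (fprod (Fact (PVar g) (ELam xs e)) (Fact p (EApp g xs)))
        (override_on d b {g}))
      = (\<Sum>t\<in>web (ty g). fval (fprod (Fact (PVar g) (ELam xs e)) (Fact p (EApp g xs))) (?d t))"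
      unfolding sum_assigns_single
      by (intro sum.cong refl arg_cong[where f = "fval _"]) (auto simp: override_on_def fun_eq_iff)
    also have "\<dots> = (\<Sum>t\<in>web (ty g). if t = ?t then sem e (restrict d (FV e)) (pval p d) else 0)"
    proof (rule sum.cong[OF refl])
      fix t assume t: "t \<in> web (ty g)"
      then obtain a b where ab: "t = Pr a b" using assms(1) by auto
      have "?d t \<in> assigns ?W"
        using d t assms(2) by (auto simp: assigns_def PiE_def Pi_def extensional_def)
      then have "fval (fprod (Fact (PVar g) (ELam xs e)) (Fact p (EApp g xs))) (?d t)
          = sem (ELam xs e) (restrict (?d t) (FV (ELam xs e))) (pval (PVar g) (?d t))
            * sem (EApp g xs) (restrict (?d t) (FV (EApp g xs))) (pval p (?d t))"
        by (rule fval_fprod_Fact) simp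
      moreover have "pval p (?d t) = pval p d" "pval xs (restrict (?d t) (FV (EApp g xs))) = pval xs d"
        using assms(4) gx by (auto simp: pval_eq_iff)
      moreover have "restrict (override_on (restrict (?d t) (FV (ELam xs e))) (pasg xs (pval xs d))
          (pvars xs)) (FV e) = restrict d (FV e)"
        using assms(2,3) unfolding pa
        by (auto simp: override_on_def restrict_def fun_eq_iff)
      ultimately show "fval (fprod (Fact (PVar g) (ELam xs e)) (Fact p (EApp g xs))) (?d t)
          = (if t = ?t then sem e (restrict d (FV e)) (pval p d) else 0)"
        by (auto simp: ab)
    qed
    also have "\<dots> = sem e (restrict d (FV e)) (pval p d)"
    proof -
      \<comment> \<open>The selected pair must lie in the web summed over, or the sum would
        vanish.\<close>
      have "?t \<in> web (ty g)" using web assms(1) by simp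
      then show ?thesis by (simp add: finite_web)
    qed
    finally show ?thesis .
  qed
  then show ?thesis
    unfolding Fact_def[of p e] fsum_def fvars_fprod fvars_Fact S pval_restrict
    by (intro mk_factor_cong V) (simp only:)
qed


section \<open>Scoping of let-terms\<close>

lemma FVl_simps [simp]:
  "FVl (Out w) = pvars w"
  "FVl (LLet p e l) = FV e \<union> (FVl l - pvars p)"
  by (simp_all add: FVl_def)

lemma finite_FV [simp]: "finite (FV e)"
  by (induction e) auto

lemma finite_all_vars [simp]: "finite (all_vars l)"
  by (simp add: all_vars_def FVl_def)

lemma defined_vars_bv: "defined_vars l \<subseteq> set (bv_list (lexp l))"
  by (induction l) (auto simp: pvars_def)

text \<open>The part of typing and of the variable convention that is stable under the transformations:
  patterns and expressions of the result may contain \<^const>\<open>PUnit\<close>, and binders inside the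
  expressions may repeat.\<close>

fun well_scoped :: "lterm \<Rightarrow> bool" where
  "well_scoped (Out w) \<longleftrightarrow> (\<forall>v\<in>pvars w. \<not> arrow_var v)"
| "well_scoped (LLet p e l) \<longleftrightarrow>
     (\<forall>u\<in>pvars p. \<forall>v\<in>pvars p. arrow_var u \<longrightarrow> arrow_var v \<longrightarrow> u = v) \<and>
     pvars p \<inter> FV e = {} \<and> (pvars p \<union> FV e) \<inter> defined_vars l = {} \<and>
     FVa e \<inter> FVl l = {} \<and> well_scoped l"

lemma well_scoped_defined_free: "well_scoped l \<Longrightarrow> defined_vars l \<inter> FVl l = {}"
  by (induction l) auto

lemma well_scoped_output: "well_scoped l \<Longrightarrow> v \<in> pvars (output_pat l) \<Longrightarrow> \<not> arrow_var v"
  by (induction l) auto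

lemma parrow_None: "parrow p = None \<longleftrightarrow> (\<forall>v\<in>pvars p. \<not> arrow_var v)"
  by (auto simp: parrow_def pvars_def find_None_iff)

lemma parrow_Some: "parrow p = Some f \<Longrightarrow> f \<in> pvars p \<and> arrow_var f"
  by (auto simp: parrow_def pvars_def find_Some_iff)

text \<open>\<open>parrow\<close> returns the first arrow variable of the pattern; if there is at
  most one, only the set of arrow variables matters.\<close>

lemma parrow_eqI:
  assumes "{v \<in> pvars p. arrow_var v} = {v \<in> pvars q. arrow_var v}"
    "\<forall>u\<in>pvars p. \<forall>v\<in>pvars p. arrow_var u \<longrightarrow> arrow_var v \<longrightarrow> u = v"
  shows "parrow p = parrow q"
proof (cases "parrow p")
  case None
  with assms(1) have "parrow q = None" by (auto simp: parrow_None)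
  with None show ?thesis by simp
next
  case (Some f)
  with assms(1) have "parrow q \<noteq> None" using parrow_Some by (auto simp: parrow_None)
  then obtain g where "parrow q = Some g" by auto
  with Some assms parrow_Some[of p f] parrow_Some[of q g] show ?thesis by auto
qed

section \<open>Elimination of the arrow variables\<close>

text \<open>Treats definitions with and without an arrow variable by one equation.\<close>

definition velim :: "var option \<Rightarrow> factor multiset \<Rightarrow> factor multiset" where
  "velim o' \<Gamma> = (case o' of None \<Rightarrow> \<Gamma> | Some f \<Rightarrow> elim {f} {f} \<Gamma>)"

lemma mvars_velim: "mvars (velim o' \<Gamma>) = mvars \<Gamma> - set_option o'"
  by (cases o') (auto simp: velim_def mvars_elim)

lemma velim_add: "fvars \<phi> \<inter> set_option o' = {} \<Longrightarrow> velim o' (add_mset \<phi> \<Gamma>) = add_mset \<phi> (velim o' \<Gamma>)"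
  by (cases o') (auto simp: velim_def elim_add_disjoint)

lemma velim_elim:
  "finite S \<Longrightarrow> S \<subseteq> W \<Longrightarrow> set_option o' \<inter> W = {} \<Longrightarrow> velim o' (elim W S \<Gamma>) = elim W S (velim o' \<Gamma>)"
  by (cases o') (auto simp: velim_def intro!: elim_commute)

lemma velim_velim: "velim a (velim b \<Gamma>) = velim b (velim a \<Gamma>)"
proof (cases "a = b")
  case False
  then show ?thesis
    by (cases a; cases b) (auto simp: velim_def intro!: elim_commute)
qed simp

text \<open>The output of a well-scoped term contains no arrow variable, so the side condition on
  the output in \<open>Facts\<close> always holds. This equation replaces the defining one from here
  on.\<close>

lemma Facts_LLet:
  assumes "well_scoped (LLet p e l)"
  shows "Facts (LLet p e l) = velim (parrow p) (add_mset (Fact p e) (Facts l))"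
proof (cases "parrow p")
  case (Some f)
  then have "f \<in> pvars p" "arrow_var f" using parrow_Some by auto
  with assms well_scoped_output[of l] Some show ?thesis
    by (auto simp: velim_def elim_def fprods_add_mset)
qed (simp add: velim_def)

declare Facts.simps(2) [simp del]

lemma set_parrow:
  assumes "\<forall>u\<in>pvars p. \<forall>v\<in>pvars p. arrow_var u \<longrightarrow> arrow_var v \<longrightarrow> u = v"
  shows "set_option (parrow p) = {v \<in> pvars p. arrow_var v}"
proof (cases "parrow p")
  case (Some f)
  with assms parrow_Some[OF Some] show ?thesis by auto
next
  case None
  then show ?thesis using iffD1[OF parrow_None None] by auto
qed

text \<open>Arrow variables disappear at their definition; every other defined variable and every
  free one remains in some factor.\<close>

lemma mvars_Facts:
  "well_scoped l \<Longrightarrow> mvars (Facts l) = FVl l \<union> {v \<in> defined_vars l. \<not> arrow_var v}"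
proof (induction l)
  case (LLet p e l)
  then have "mvars (Facts (LLet p e l)) = FV e \<union> pvars p \<union> mvars (Facts l) - {v \<in> pvars p. arrow_var v}"
    by (subst Facts_LLet) (auto simp: mvars_velim set_parrow)
  moreover have "mvars (Facts l) = FVl l \<union> {v \<in> defined_vars l. \<not> arrow_var v}"
    "pvars p \<inter> FV e = {}" "pvars p \<inter> defined_vars l = {}"
    using LLet by auto
  ultimately show ?case unfolding FVl_simps defined_vars.simps by blast
qed simp

section \<open>Merging two definitions\<close>

text \<open>Variables created by a transformation are fresh for \<open>A\<close>, whence the last conjunct.\<close>

definition refines :: "var set \<Rightarrow> lterm \<Rightarrow> lterm \<Rightarrow> bool" where
  "refines A l l' \<longleftrightarrow> well_scoped l' \<and> FVl l' \<subseteq> FVl l \<and> output_pat l' = output_pat l \<and>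
     defined_vars l' \<inter> A \<subseteq> defined_vars l"

lemma refines_refl: "well_scoped l \<Longrightarrow> refines A l l"
  by (auto simp: refines_def)

lemma refines_trans: "refines A l l' \<Longrightarrow> refines A l' l'' \<Longrightarrow> refines A l l''"
  by (auto simp: refines_def)

text \<open>Variables newly defined in \<open>l'\<close> lie outside \<open>A\<close>, hence cannot
  clash with those of the definition put in front.\<close>

lemma refines_LLet:
  assumes "refines A l l'" "well_scoped (LLet p e l)" "pvars p \<union> FV e \<subseteq> A"
  shows "refines A (LLet p e l) (LLet p e l')"
proof -
  from assms(1) have r: "well_scoped l'" "FVl l' \<subseteq> FVl l" "output_pat l' = output_pat l"
    "defined_vars l' \<inter> A \<subseteq> defined_vars l"
    by (simp_all add: refines_def)
  have "(pvars p \<union> FV e) \<inter> defined_vars l' = {}" "FVa e \<inter> FVl l' = {}"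
    using r assms(2,3) by auto
  with r assms(2) show ?thesis unfolding refines_def by auto
qed

lemma refines_merge:
  assumes "well_scoped (LLet p1 e1 (LLet p2 e2 l))"
    "pvars q \<subseteq> pvars p1" "\<forall>v\<in>pvars q. \<not> arrow_var v" "(pvars p1 - pvars q) \<inter> FVl l = {}"
  shows "refines A (LLet p1 e1 (LLet p2 e2 l)) (LLet (ppair q p2) (ELet p1 e1 (epair q e2)) l)"
proof -
  let ?l = "LLet (ppair q p2) (ELet p1 e1 (epair q e2)) l"
  have "FVa (ELet p1 e1 (epair q e2)) \<inter> FVl l = {}"
    using assms by (auto simp: FVa_def)
  moreover have "u = v"
    if "u \<in> pvars (ppair q p2)" "v \<in> pvars (ppair q p2)" "arrow_var u" "arrow_var v" for u v
    using assms that by auto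
  moreover have "pvars (ppair q p2) \<inter> FV (ELet p1 e1 (epair q e2)) = {}"
    using assms(1,2) by auto
  moreover have "(pvars (ppair q p2) \<union> FV (ELet p1 e1 (epair q e2))) \<inter> defined_vars l = {}"
    using assms(1,2) by auto
  ultimately have "well_scoped ?l"
    using assms(1) by simp
  moreover have "FVl ?l \<subseteq> FVl (LLet p1 e1 (LLet p2 e2 l))"
    using assms(2,4) by auto
  ultimately show ?thesis
    using assms(2) unfolding refines_def by auto
qed

text \<open>\<open>W\<close> meets the factors of both definitions and no factor of
  \<open>l\<close>, so eliminating on \<open>W\<close> multiplies exactly these two. The arrow
  variable of \<open>p2\<close> lies outside \<open>W\<close>, so its elimination can be exchanged
  with the one on \<open>W\<close>.\<close>

lemma Facts_merge:
  assumes ws: "well_scoped (LLet p1 e1 (LLet p2 e2 l))"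
    and q: "pvars q \<subseteq> pvars p1" "\<forall>v\<in>pvars q. \<not> arrow_var v"
    and W: "pvars p1 - pvars q \<subseteq> W" "W \<inter> (FV e1 \<union> pvars p1) \<noteq> {}" "W \<inter> FV e2 \<noteq> {}"
      "W \<inter> (FVl l \<union> pvars p2 \<union> defined_vars l) = {}"
  shows "Facts (LLet (ppair q p2) (ELet p1 e1 (epair q e2)) l)
    = elim W (pvars p1 - pvars q) (add_mset (Fact p1 e1) (Facts (LLet p2 e2 l)))"
proof -
  let ?S = "pvars p1 - pvars q"
  let ?o = "parrow p2"
  have ws': "well_scoped (LLet (ppair q p2) (ELet p1 e1 (epair q e2)) l)"
  proof -
    have "?S \<inter> FVl l = {}" using W(1,4) by blast
    from refines_merge[OF ws q this] show ?thesis unfolding refines_def by blast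
  qed
  have o: "set_option ?o = {v \<in> pvars p2. arrow_var v}"
    using ws by (intro set_parrow) simp
  have po: "parrow (ppair q p2) = ?o"
    by (rule parrow_eqI) (use q ws' in auto)
  have "mvars (Facts l) \<subseteq> FVl l \<union> defined_vars l"
    using mvars_Facts[of l] ws by auto
  with W(4) have d: "mvars (Facts l) \<inter> W = {}" by blast
  have d1: "pvars p1 \<inter> FV e1 = {}" "pvars p1 \<inter> pvars p2 = {}" "FV e1 \<inter> pvars p2 = {}"
    using ws by auto
  have n: "(FV e1 \<union> pvars p1) \<inter> W \<noteq> {}" "(FV e2 \<union> pvars p2) \<inter> W \<noteq> {}"
    using W(2,3) by blast+
  have "Fact (ppair q p2) (ELet p1 e1 (epair q e2)) = fsum ?S (fprod (Fact p1 e1) (Fact p2 e2))"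
    by (rule Fact_merge[OF q(1) d1(1)]) (use d1(2) in blast)
  also have "fprod (Fact p1 e1) (Fact p2 e2) = fprods {#Fact p1 e1, Fact p2 e2#}"
    using fprods_single[of "FV e2 \<union> pvars p2"] by (simp add: fprods_add_mset Fact_def)
  finally have "add_mset (Fact (ppair q p2) (ELet p1 e1 (epair q e2))) (Facts l)
      = elim W ?S (add_mset (Fact p1 e1) (add_mset (Fact p2 e2) (Facts l)))"
    using n by (simp add: elim_def touching_disjoint[OF d] avoiding_disjoint[OF d])
  then have "Facts (LLet (ppair q p2) (ELet p1 e1 (epair q e2)) l)
      = velim ?o (elim W ?S (add_mset (Fact p1 e1) (add_mset (Fact p2 e2) (Facts l))))"
    using ws' by (subst Facts_LLet) (simp_all add: po)
  also have "\<dots> = elim W ?S (velim ?o (add_mset (Fact p1 e1) (add_mset (Fact p2 e2) (Facts l))))"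
    by (rule velim_elim) (use W(1,4) o in \<open>simp, blast+\<close>)
  also have "velim ?o (add_mset (Fact p1 e1) (add_mset (Fact p2 e2) (Facts l)))
      = add_mset (Fact p1 e1) (velim ?o (add_mset (Fact p2 e2) (Facts l)))"
    by (rule velim_add) (use d1 o in \<open>simp, blast\<close>)
  also have "velim ?o (add_mset (Fact p2 e2) (Facts l)) = Facts (LLet p2 e2 l)"
    using ws by (subst Facts_LLet) simp_all
  finally show ?thesis .
qed


section \<open>Swapping definitions\<close>

lemma pos_not_arrow: "pos_var v \<Longrightarrow> \<not> arrow_var v"
  by (auto simp: pos_var_def arrow_var_def)

lemma arrow_parrow:
  assumes "f \<in> pvars p" "arrow_var f"
    "\<forall>u\<in>pvars p. \<forall>v\<in>pvars p. arrow_var u \<longrightarrow> arrow_var v \<longrightarrow> u = v"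
  shows "parrow p = Some f"
proof (cases "parrow p")
  case None
  with assms parrow_None[of p] show ?thesis by simp
next
  case (Some g)
  with assms parrow_Some[OF Some] show ?thesis by auto
qed

lemma ppos_diff: "pvars p - pvars (ppos p) = {v \<in> pvars p. arrow_var v}"
  by (auto simp: ppos_def)

section \<open>Soundness of the three rules for adjacent definitions\<close>

context
  fixes p1 p2 e1 e2 l
  assumes ws: "well_scoped (LLet p1 e1 (LLet p2 e2 l))"
begin

private lemma scopes:
  "pvars p1 \<inter> FV e1 = {}" "pvars p1 \<inter> pvars p2 = {}" "pvars p1 \<inter> defined_vars l = {}"
  "FV e1 \<inter> pvars p2 = {}" "FV e1 \<inter> defined_vars l = {}" "FVa e1 \<inter> FV e2 = {}"
  "FVa e1 \<inter> (FVl l - pvars p2) = {}" "pvars p2 \<inter> FV e2 = {}" "pvars p2 \<inter> defined_vars l = {}"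
  "FV e2 \<inter> defined_vars l = {}" "FVa e2 \<inter> FVl l = {}" "well_scoped l" "well_scoped (LLet p2 e2 l)"
  using ws by auto

private lemma arrow_unique:
  "\<forall>u\<in>pvars p1. \<forall>v\<in>pvars p1. arrow_var u \<longrightarrow> arrow_var v \<longrightarrow> u = v"
  "\<forall>u\<in>pvars p2. \<forall>v\<in>pvars p2. arrow_var u \<longrightarrow> arrow_var v \<longrightarrow> u = v"
  using ws by auto

text \<open>Normal form with both arrow eliminations outermost, through which swapping and
  abstraction are compared.\<close>

lemma Facts_LLet_LLet:
  "Facts (LLet p1 e1 (LLet p2 e2 l)) = velim (parrow p1) (velim (parrow p2)
     (add_mset (Fact p1 e1) (add_mset (Fact p2 e2) (Facts l))))"
proof -
  have "fvars (Fact p1 e1) \<inter> set_option (parrow p2) = {}"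
    unfolding fvars_Fact set_parrow[OF arrow_unique(2)] using scopes by blast
  then show ?thesis
    by (simp only: Facts_LLet[OF ws] Facts_LLet[OF scopes(13)] velim_add)
qed

text \<open>Neither factor contains the arrow variable defined by the other, so both orders reduce
  to the same two commuting eliminations on the same collection.\<close>

lemma SD_swap:
  assumes "pvars p1 \<inter> FV e2 = {}"
  shows "refines A (LLet p1 e1 (LLet p2 e2 l)) (LLet p2 e2 (LLet p1 e1 l))"
    and "Facts (LLet p2 e2 (LLet p1 e1 l)) = Facts (LLet p1 e1 (LLet p2 e2 l))"
proof -
  have "FVa e1 \<inter> FVl l = {}" using scopes FVa_def by auto
  moreover have "FVa e2 \<inter> FVl (LLet p1 e1 l) = {}" using scopes by (auto simp: FVa_def)
  ultimately have ws': "well_scoped (LLet p2 e2 (LLet p1 e1 l))"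
    using ws assms by auto
  moreover have "FVl (LLet p2 e2 (LLet p1 e1 l)) \<subseteq> FVl (LLet p1 e1 (LLet p2 e2 l))"
    using scopes(1,4,8) assms by auto
  ultimately show "refines A (LLet p1 e1 (LLet p2 e2 l)) (LLet p2 e2 (LLet p1 e1 l))"
    by (auto simp: refines_def)
  have ws1: "well_scoped (LLet p1 e1 l)" using ws' by simp
  have "fvars (Fact p2 e2) \<inter> set_option (parrow p1) = {}"
    unfolding fvars_Fact set_parrow[OF arrow_unique(1)] using scopes(2) assms by auto
  then show "Facts (LLet p2 e2 (LLet p1 e1 l)) = Facts (LLet p1 e1 (LLet p2 e2 l))"
    by (simp only: Facts_LLet[OF ws'] Facts_LLet[OF ws1] Facts_LLet_LLet velim_add[symmetric]
        add_mset_commute velim_velim[of "parrow p1" "parrow p2"])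
qed

text \<open>The elimination of \<open>g\<close> is moved innermost. Only the abstraction and its
  application contain \<open>g\<close>, and eliminating it there restores the factor of the original
  definition.\<close>

lemma SD_abstract:
  assumes xs: "pvars xs = pvars p1 \<inter> FV e2" "\<forall>v\<in>pvars xs. pos_var v"
    and g: "ty g = Lolli (pty xs) (pty p2)" "g \<notin> A" "g \<notin> FV e1" "g \<notin> FV e2" "g \<notin> FVl l"
      "g \<notin> pvars p1" "g \<notin> pvars p2" "g \<notin> defined_vars l"
  shows "refines A (LLet p1 e1 (LLet p2 e2 l))
      (LLet (PVar g) (ELam xs e2) (LLet p1 e1 (LLet p2 (EApp g xs) l)))"
    and "Facts (LLet (PVar g) (ELam xs e2) (LLet p1 e1 (LLet p2 (EApp g xs) l)))
      = Facts (LLet p1 e1 (LLet p2 e2 l))"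
proof -
  let ?l2 = "LLet p2 (EApp g xs) l"
  let ?l1 = "LLet p1 e1 ?l2"
  let ?l0 = "LLet (PVar g) (ELam xs e2) ?l1"
  have ag: "arrow_var g" using g(1) by (simp add: arrow_var_def)
  have xa: "\<forall>v\<in>pvars xs. \<not> arrow_var v" using xs(2) pos_not_arrow by blast
  \<comment> \<open>The abstracted variables are positive, so the application consumes no other
    arrow variable and linearity is preserved.\<close>
  have "FVa (EApp g xs) = {g}" using ag xa by (auto simp: FVa_def)
  then have "FVa (EApp g xs) \<inter> FVl l = {}" using g by simp
  moreover have "pvars p2 \<inter> FV (EApp g xs) = {}" "FV (EApp g xs) \<inter> defined_vars l = {}"
    using xs(1) g scopes by auto
  ultimately have w2: "well_scoped ?l2"
    using scopes arrow_unique by auto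
  have "FVa e1 \<inter> FVl ?l2 = {}"
    using xs(1) g scopes by (auto simp: FVa_def)
  then have w1: "well_scoped ?l1"
    using w2 scopes arrow_unique by auto
  have "FVa (ELam xs e2) \<inter> FVl ?l1 = {}"
    using xs(1) g scopes by (auto simp: FVa_def)
  moreover have "({g} \<union> FV (ELam xs e2)) \<inter> defined_vars ?l1 = {}"
    using xs(1) g scopes by auto
  moreover have "{g} \<inter> FV (ELam xs e2) = {}" using g by simp
  ultimately have w0: "well_scoped ?l0"
    using w1 by (simp del: FV.simps FVl_simps defined_vars.simps)
  have "FVl ?l0 \<subseteq> FVl (LLet p1 e1 (LLet p2 e2 l))"
    using xs(1) scopes by auto
  with w0 show "refines A (LLet p1 e1 (LLet p2 e2 l)) ?l0"
    using g(2) by (auto simp: refines_def)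
  let ?g = "parrow (PVar g)"
  have og: "?g = Some g" using ag by (simp add: parrow_def)
  have "fvars (Fact p1 e1) \<inter> set_option (parrow p2) = {}"
    unfolding fvars_Fact set_parrow[OF arrow_unique(2)] using scopes by blast
  moreover have "fvars (Fact (PVar g) (ELam xs e2)) \<inter> set_option (parrow p2) = {}"
    unfolding fvars_Fact set_parrow[OF arrow_unique(2)] using scopes(8) g(7) by auto
  moreover have "fvars (Fact (PVar g) (ELam xs e2)) \<inter> set_option (parrow p1) = {}"
    unfolding fvars_Fact set_parrow[OF arrow_unique(1)] using xs(1) g(6) by auto
  ultimately have "Facts ?l0 = velim (parrow p1) (velim (parrow p2) (velim ?g
      (add_mset (Fact (PVar g) (ELam xs e2)) (add_mset (Fact p1 e1)
         (add_mset (Fact p2 (EApp g xs)) (Facts l))))))"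
    by (simp only: Facts_LLet[OF w0] Facts_LLet[OF w1] Facts_LLet[OF w2] velim_add[symmetric]
        velim_velim[of ?g])
  also have "velim ?g (add_mset (Fact (PVar g) (ELam xs e2)) (add_mset (Fact p1 e1)
         (add_mset (Fact p2 (EApp g xs)) (Facts l)))) = add_mset (Fact p1 e1)
       (add_mset (Fact p2 e2) (Facts l))"
  proof -
    have "mvars (Facts l) \<subseteq> FVl l \<union> defined_vars l"
      using mvars_Facts[OF scopes(12)] by auto
    then have d: "mvars (Facts l) \<inter> {g} = {}" using g by auto
    have "fprod (Fact (PVar g) (ELam xs e2)) (Fact p2 (EApp g xs))
      = fprods {#Fact (PVar g) (ELam xs e2), Fact p2 (EApp g xs)#}"
      using fprods_single[of "FV (EApp g xs) \<union> pvars p2"] by (simp add: fprods_add_mset Fact_def)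
    moreover have "fsum {g} (fprod (Fact (PVar g) (ELam xs e2)) (Fact p2 (EApp g xs))) = Fact p2 e2"
      by (rule Fact_abstract) (use xs g in auto)
    ultimately show ?thesis
      using g by (simp add: og velim_def elim_def touching_disjoint[OF d] avoiding_disjoint[OF d])
  qed
  finally show "Facts ?l0 = Facts (LLet p1 e1 (LLet p2 e2 l))"
    by (simp only: Facts_LLet_LLet)
qed

text \<open>By linearity \<open>f\<close>, being free in \<open>e2\<close>, does not occur in
  \<open>l\<close>. Merging therefore performs the elimination of \<open>f\<close> that
  \<open>Facts\<close> carries out at the definition of \<open>p1\<close>.\<close>

lemma SD_merge:
  assumes f: "f \<in> pvars p1" "arrow_var f" "f \<in> FV e2"
  shows "refines A (LLet p1 e1 (LLet p2 e2 l))
      (LLet (ppair (ppos p1) p2) (ELet p1 e1 (epair (ppos p1) e2)) l)"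
    and "Facts (LLet (ppair (ppos p1) p2) (ELet p1 e1 (epair (ppos p1) e2)) l)
      = Facts (LLet p1 e1 (LLet p2 e2 l))"
proof -
  have S: "pvars p1 - pvars (ppos p1) = {f}"
    unfolding ppos_diff using f arrow_unique by auto
  have fa: "f \<notin> FVl l" "f \<notin> pvars p2" "f \<notin> defined_vars l"
    using f scopes by (auto simp: FVa_def)
  have q: "pvars (ppos p1) \<subseteq> pvars p1" "\<forall>v\<in>pvars (ppos p1). \<not> arrow_var v"
    by (auto simp: ppos_def)
  show "refines A (LLet p1 e1 (LLet p2 e2 l))
      (LLet (ppair (ppos p1) p2) (ELet p1 e1 (epair (ppos p1) e2)) l)"
    by (rule refines_merge[OF ws q]) (use S fa in auto)
  have "Facts (LLet (ppair (ppos p1) p2) (ELet p1 e1 (epair (ppos p1) e2)) l)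
      = elim {f} {f} (add_mset (Fact p1 e1) (Facts (LLet p2 e2 l)))"
    unfolding S[symmetric] by (rule Facts_merge[OF ws q]) (unfold S, use f fa in auto)
  also have "\<dots> = Facts (LLet p1 e1 (LLet p2 e2 l))"
    by (simp add: Facts_LLet[OF ws] arrow_parrow[OF f(1,2) arrow_unique(1)] velim_def)
  finally show "Facts (LLet (ppair (ppos p1) p2) (ELet p1 e1 (epair (ppos p1) e2)) l)
      = Facts (LLet p1 e1 (LLet p2 e2 l))" .
qed

text \<open>The last conjunct keeps gathered factors in front: under each rule the new first
  definition retains the variables of \<open>e2\<close> that \<open>p1\<close> does not define,
  since abstraction binds only variables of \<open>p1\<close>.\<close>

lemma SD_correct:
  assumes ok: "\<forall>v\<in>pvars p1. pos_var v \<or> arrow_var v" and A: "finite A"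
  shows "\<exists>p e l'. SD A (LLet p1 e1 (LLet p2 e2 l)) = LLet p e l' \<and>
    refines A (LLet p1 e1 (LLet p2 e2 l)) (LLet p e l') \<and>
    Facts (LLet p e l') = Facts (LLet p1 e1 (LLet p2 e2 l)) \<and>
    (\<forall>V. V \<subseteq> FV e2 \<longrightarrow> V \<inter> (FV e1 \<union> pvars p1 \<union> FVl l) = {} \<longrightarrow> V \<subseteq> FV e \<and> V \<inter> FVl l' = {})"
proof -
  let ?L = "LLet p1 e1 (LLet p2 e2 l)"
  \<comment> \<open>If the shared variables are not all positive, \<open>ok\<close> yields an arrow
    variable among them.\<close>
  consider (swap) "pvars p1 \<inter> FV e2 = {}"
    | (abstract) "pvars p1 \<inter> FV e2 \<noteq> {}" "\<forall>v\<in>pvars p1 \<inter> FV e2. pos_var v"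
    | (merge) f where "pvars p1 \<inter> FV e2 \<noteq> {}" "\<not> (\<forall>v\<in>pvars p1 \<inter> FV e2. pos_var v)"
        "f \<in> pvars p1" "arrow_var f" "f \<in> FV e2"
    using ok by blast
  then show ?thesis
  proof cases
    case swap
    then have "SD A ?L = LLet p2 e2 (LLet p1 e1 l)" by simp
    with SD_swap[OF swap] show ?thesis
      by (intro exI[of _ p2] exI[of _ e2] exI[of _ "LLet p1 e1 l"]) auto
  next
    case abstract
    define xs where "xs = pfilter (\<lambda>v. v \<in> FV e2) p1"
    define g where "g = fresh (A \<union> all_vars ?L) (Lolli (pty xs) (pty p2))"
    have SD: "SD A ?L = LLet (PVar g) (ELam xs e2) (LLet p1 e1 (LLet p2 (EApp g xs) l))"
      using abstract by (simp add: Let_def xs_def g_def)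
    have xs: "pvars xs = pvars p1 \<inter> FV e2" "\<forall>v\<in>pvars xs. pos_var v"
      using abstract(2) by (auto simp: xs_def)
    have "ty g = Lolli (pty xs) (pty p2)" and gA: "g \<notin> A \<union> all_vars ?L"
      unfolding g_def using A by (simp_all only: fresh finite_Un finite_all_vars simp_thms)
    moreover have "FVl ?L \<union> defined_vars ?L \<subseteq> all_vars ?L"
      using defined_vars_bv[of ?L] by (auto simp: all_vars_def simp del: FVl_simps)
    then have "FV e1 \<union> FV e2 \<union> FVl l \<union> pvars p1 \<union> pvars p2 \<union> defined_vars l \<subseteq> all_vars ?L"
      by auto
    ultimately have g: "ty g = Lolli (pty xs) (pty p2)" "g \<notin> A" "g \<notin> FV e1" "g \<notin> FV e2"
        "g \<notin> FVl l" "g \<notin> pvars p1" "g \<notin> pvars p2" "g \<notin> defined_vars l"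
      by auto
    show ?thesis
      using SD SD_abstract[OF xs g] xs(1) g(4)
      by (intro exI[of _ "PVar g"] exI[of _ "ELam xs e2"]
          exI[of _ "LLet p1 e1 (LLet p2 (EApp g xs) l)"]) auto
  next
    case merge
    have "SD A ?L = LLet (ppair (ppos p1) p2) (ELet p1 e1 (epair (ppos p1) e2)) l"
      using merge(1,2) by (simp only: SD.simps if_False)
    with SD_merge[OF merge(3-5)] show ?thesis
      by (intro exI[of _ "ppair (ppos p1) p2"] exI[of _ "ELet p1 e1 (epair (ppos p1) e2)"]
          exI[of _ l]) auto
  qed
qed

end


section \<open>Correctness of the elimination on let-terms\<close>

text \<open>Required of the terms to be transformed only: \<^const>\<open>refines\<close> does not preserve it.\<close>

fun arrows_used :: "lterm \<Rightarrow> bool" where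
  "arrows_used (Out w) \<longleftrightarrow> True"
| "arrows_used (LLet p e l) \<longleftrightarrow>
     (\<forall>v\<in>pvars p. pos_var v \<or> arrow_var v) \<and> (\<forall>v\<in>pvars p. arrow_var v \<longrightarrow> v \<in> FVl l) \<and>
     arrows_used l"

section \<open>Gathering all factors that meet a set of variables\<close>

lemma touching_cong:
  assumes "mvars \<Gamma> \<inter> U = mvars \<Gamma> \<inter> W"
  shows "touching \<Gamma> U = touching \<Gamma> W"
  unfolding touching_def
proof (rule filter_mset_cong[OF refl])
  fix \<phi> assume "\<phi> \<in># \<Gamma>"
  then have "fvars \<phi> \<subseteq> mvars \<Gamma>" by (auto simp: mvars_def)
  then have "fvars \<phi> \<inter> U = fvars \<phi> \<inter> W" using assms by blast
  then show "fvars \<phi> \<inter> U \<noteq> {} \<longleftrightarrow> fvars \<phi> \<inter> W \<noteq> {}" by simp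
qed

text \<open>What \<^const>\<open>VA\<close> delivers: the factors meeting \<open>U\<close> have been multiplied into the first
  definition of the term.\<close>

definition gathered :: "var set \<Rightarrow> lterm \<Rightarrow> var set \<Rightarrow> pat \<Rightarrow> exp \<Rightarrow> lterm \<Rightarrow> bool" where
  "gathered A l U p e l' \<longleftrightarrow> refines A l (LLet p e l') \<and> U \<subseteq> FV e \<and> U \<inter> FVl l' = {} \<and>
     Facts (LLet p e l') = elim U {} (Facts l)"

text \<open>The step common to all merging cases. Within \<open>l\<close> only \<open>U\<close>, the
  part of \<open>W\<close> free there, has been gathered; the remaining variables of
  \<open>W\<close> occur in no factor of \<open>l\<close>. The gathered product is collected again
  with the first factor, which gives a single elimination on \<open>W\<close>.\<close>

lemma merge_gathered:
  assumes ws: "well_scoped (LLet p1 e1 l)" and A: "pvars p1 \<union> FV e1 \<union> FVl l \<subseteq> A"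
    and q: "pvars q \<subseteq> pvars p1" "\<forall>v\<in>pvars q. \<not> arrow_var v"
    and U: "gathered A l U p2 e2 l2" "U \<noteq> {}"
    and W: "U = W \<inter> FVl l" "pvars p1 - pvars q \<subseteq> U" "W \<subseteq> FV e1 \<union> FVl l"
      "W \<inter> (FV e1 \<union> pvars p1) \<noteq> {}"
  defines "l' \<equiv> LLet (ppair q p2) (ELet p1 e1 (epair q e2)) l2"
  shows "refines A (LLet p1 e1 l) l'"
    and "Facts l' = elim W (pvars p1 - pvars q) (add_mset (Fact p1 e1) (Facts l))"
    and "W \<inter> FVl l2 = {}"
proof -
  let ?S = "pvars p1 - pvars q"
  let ?L = "LLet p1 e1 (LLet p2 e2 l2)"
  have r: "refines A l (LLet p2 e2 l2)" and Ue: "U \<subseteq> FV e2" and Ul: "U \<inter> FVl l2 = {}"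
    and F: "Facts (LLet p2 e2 l2) = elim U {} (Facts l)"
    using U(1) by (simp_all add: gathered_def)
  have rL: "refines A (LLet p1 e1 l) ?L"
    by (rule refines_LLet[OF r ws]) (use A in blast)
  then have wsL: "well_scoped ?L" by (simp add: refines_def)
  have "?S \<inter> FVl l2 = {}" using W(2) Ul by blast
  from refines_trans[OF rL refines_merge[OF wsL q this]]
  show "refines A (LLet p1 e1 l) l'" by (simp add: l'_def)
  have wsl: "well_scoped l" and d1: "FV e1 \<inter> defined_vars l = {}"
    using ws by auto
  have d2: "defined_vars l \<inter> FVl l = {}"
    by (rule well_scoped_defined_free[OF wsl])
  have Wd: "W \<inter> defined_vars l = {}" using W(3) d1 d2 by blast
  have WA: "W \<subseteq> A" using W(3) A by blast
  have "(pvars p2 \<union> defined_vars l2) \<inter> A \<subseteq> defined_vars l"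
    and fv: "FV e2 \<union> (FVl l2 - pvars p2) \<subseteq> FVl l"
    using r by (auto simp: refines_def)
  \<comment> \<open>A variable defined after gathering is outside \<open>A\<close> or already
    defined in \<open>l\<close>, while \<open>W\<close> lies in \<open>A\<close> and contains none
    defined in \<open>l\<close>.\<close>
  then have W2: "W \<inter> (pvars p2 \<union> defined_vars l2) = {}" using WA Wd by blast
  then show Wl: "W \<inter> FVl l2 = {}" using fv W(1) Ul by blast
  have "Facts l' = elim W ?S (add_mset (Fact p1 e1) (Facts (LLet p2 e2 l2)))"
    unfolding l'_def
    by (rule Facts_merge[OF wsL q]) (use W U(2) Ue W2 Wl in blast)+
  also have "\<dots> = elim W ?S (add_mset (Fact p1 e1) (Facts l))"
  proof -
    have m: "FVl l \<subseteq> mvars (Facts l)" "mvars (Facts l) \<subseteq> FVl l \<union> defined_vars l"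
      using mvars_Facts[OF wsl] by auto
    then have "touching (Facts l) U = touching (Facts l) W"
      by (intro touching_cong) (use W(1) Wd in blast)
    then show ?thesis
      unfolding F by (rule elim_add_elim) (use U(2) W(1) m in blast)+
  qed
  finally show "Facts l' = elim W ?S (add_mset (Fact p1 e1) (Facts l))" .
qed

text \<open>By induction on the term. Non-emptiness of \<open>V\<close> and its disjointness from
  the output rule out the base case, so there is always a definition to hold the gathered
  factors.\<close>

lemma VA_correct:
  assumes "well_scoped l" "arrows_used l" "finite A" "FVl l \<union> defined_vars l \<subseteq> A"
    "V \<subseteq> FVl l" "V \<noteq> {}" "V \<inter> pvars (output_pat l) = {}"
  shows "\<exists>p e l'. VA A l V = LLet p e l' \<and> gathered A l V p e l'"
  using assms
proof (induction l arbitrary: V)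
  case (Out w)
  then show ?case by auto
next
  case (LLet p1 e1 l)
  let ?L = "LLet p1 e1 l"
  note ws = LLet.prems(1)
  have wsl: "well_scoped l" and d1: "pvars p1 \<inter> FV e1 = {}" "pvars p1 \<inter> defined_vars l = {}"
    "FV e1 \<inter> defined_vars l = {}"
    and au: "\<forall>u\<in>pvars p1. \<forall>v\<in>pvars p1. arrow_var u \<longrightarrow> arrow_var v \<longrightarrow> u = v"
    using ws by auto
  have ok: "\<forall>v\<in>pvars p1. pos_var v \<or> arrow_var v" and use: "\<forall>v\<in>pvars p1. arrow_var v \<longrightarrow> v \<in> FVl l"
    and aul: "arrows_used l"
    using LLet.prems(2) by auto
  have A: "pvars p1 \<union> FV e1 \<union> FVl l \<subseteq> A" and Al: "FVl l \<union> defined_vars l \<subseteq> A"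
    using LLet.prems(4) by auto
  have V: "V \<subseteq> FV e1 \<union> (FVl l - pvars p1)" and Vo: "V \<inter> pvars (output_pat l) = {}"
    using LLet.prems(5,7) by auto
  have Vp: "V \<inter> pvars p1 = {}" using V d1 by blast
  have Vd: "V \<inter> defined_vars l = {}"
    using V d1(3) well_scoped_defined_free[OF wsl] by blast
  have m: "mvars (Facts l) \<subseteq> FVl l \<union> defined_vars l"
    using mvars_Facts[OF wsl] by auto
  note IH = LLet.IH[OF wsl aul \<open>finite A\<close> Al]
  consider (later) "V \<inter> FV e1 = {}"
    | (first) "V \<inter> FV e1 \<noteq> {}" "parrow p1 = None" "V \<inter> FVl l = {}"
    | (pos) "V \<inter> FV e1 \<noteq> {}" "parrow p1 = None" "V \<inter> FVl l \<noteq> {}"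
    | (arrow) f where "V \<inter> FV e1 \<noteq> {}" "parrow p1 = Some f"
    by (cases "parrow p1") auto
  then show ?case
  proof cases
    case later
    have "V \<subseteq> FVl l" using V later by blast
    from IH[OF this LLet.prems(6) Vo] obtain p2 e2 l2
      where VA: "VA A l V = LLet p2 e2 l2" and g: "gathered A l V p2 e2 l2" by blast
    let ?L2 = "LLet p1 e1 (LLet p2 e2 l2)"
    have r: "refines A ?L ?L2"
      by (rule refines_LLet[OF _ ws]) (use g A in \<open>simp_all add: gathered_def\<close>)
    then have ws2: "well_scoped ?L2" by (simp add: refines_def)
    have Vl: "V \<subseteq> FV e2" "V \<inter> FVl l2 = {}"
      using g by (simp_all add: gathered_def)
    have Vn: "V \<inter> (FV e1 \<union> pvars p1 \<union> FVl l2) = {}"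
      by (simp add: Int_Un_distrib later Vp Vl(2))
    from SD_correct[OF ws2 ok \<open>finite A\<close>] obtain p e l'
      where SD: "SD A ?L2 = LLet p e l'" and r': "refines A ?L2 (LLet p e l')"
        and F: "Facts (LLet p e l') = Facts ?L2"
        and all: "\<forall>V. V \<subseteq> FV e2 \<longrightarrow> V \<inter> (FV e1 \<union> pvars p1 \<union> FVl l2) = {}
          \<longrightarrow> V \<subseteq> FV e \<and> V \<inter> FVl l' = {}"
      by (elim exE conjE)
    have V': "V \<subseteq> FV e" "V \<inter> FVl l' = {}" using all Vl(1) Vn by simp_all
    have "Facts ?L2 = velim (parrow p1) (add_mset (Fact p1 e1) (elim V {} (Facts l)))"
      using g by (simp only: Facts_LLet[OF ws2] gathered_def)
    \<comment> \<open>The first factor does not meet \<open>V\<close>, so gathering in the tail is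
      gathering in the whole.\<close>
    also have "add_mset (Fact p1 e1) (elim V {} (Facts l)) = elim V {} (add_mset (Fact p1 e1) (Facts l))"
      by (rule elim_add_disjoint[symmetric]) (use later Vp in auto)
    also have "velim (parrow p1) \<dots> = elim V {} (velim (parrow p1) (add_mset (Fact p1 e1) (Facts l)))"
      by (rule velim_elim) (use Vp set_parrow[OF au] in auto)
    finally have "Facts ?L2 = elim V {} (Facts ?L)"
      by (simp only: Facts_LLet[OF ws])
    with F V' refines_trans[OF r r'] have "gathered A ?L V p e l'"
      by (simp only: gathered_def)
    moreover have "VA A ?L V = LLet p e l'"
      using LLet.prems(6) later SD by (simp add: VA del: SD.simps)
    ultimately show ?thesis by blast
  next
    case first
    \<comment> \<open>Only the first factor meets \<open>V\<close>, so it is gathered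
      already.\<close>
    have "mvars (Facts l) \<inter> V = {}" using m first(3) Vd by blast
    moreover have "fvars (Fact p1 e1) \<inter> V \<noteq> {}" using first(1) by auto
    moreover have F: "fprods {#Fact p1 e1#} = Fact p1 e1"
      by (simp add: Fact_def fprods_single)
    moreover have "fsum {} (Fact p1 e1) = Fact p1 e1"
      using fsum_empty[of "{#Fact p1 e1#}"] by (simp only: F)
    ultimately have "Facts ?L = elim V {} (Facts ?L)"
      using first(2)
      by (simp add: Facts_LLet[OF ws] velim_def elim_def touching_disjoint avoiding_disjoint fsum_empty
          del: fvars_Fact)
    then have "gathered A ?L V p1 e1 l"
      unfolding gathered_def using refines_refl[OF ws] V first(3) by blast
    with first LLet.prems(6) show ?thesis by simp
  next
    case pos
    from IH[OF _ pos(3)] Vo obtain p2 e2 l2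
      where VA: "VA A l (V \<inter> FVl l) = LLet p2 e2 l2" and g: "gathered A l (V \<inter> FVl l) p2 e2 l2"
      by blast
    let ?l' = "LLet (ppair p1 p2) (ELet p1 e1 (epair p1 e2)) l2"
    have "\<forall>v\<in>pvars p1. \<not> arrow_var v" using pos(2) by (simp add: parrow_None)
    \<comment> \<open>With \<open>q\<close> all of \<open>p1\<close>, nothing is summed out.\<close>
    note mg = merge_gathered[OF ws A order_refl this g pos(3) refl, simplified Diff_cancel]
    have "V \<inter> FVl l \<subseteq> FV e2" using g by (simp add: gathered_def)
    then have "V \<subseteq> FV (ELet p1 e1 (epair p1 e2))"
      unfolding FV.simps FV_epair using V Vp by blast
    moreover have "Facts ?l' = elim V {} (Facts ?L)" "refines A ?L ?l'" "V \<inter> FVl l2 = {}"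
      using mg V pos(1,2) by (auto simp: Facts_LLet[OF ws] velim_def)
    ultimately have "gathered A ?L V (ppair p1 p2) (ELet p1 e1 (epair p1 e2)) l2"
      by (simp only: gathered_def)
    with pos LLet.prems(6) VA show ?thesis by simp
  next
    case arrow
    let ?U = "V \<inter> FVl l \<union> {f}" and ?W = "V \<union> {f}"
    have f: "f \<in> pvars p1" "arrow_var f" using parrow_Some[OF arrow(2)] by auto
    have fl: "f \<in> FVl l" using f use by blast
    have fo: "f \<notin> pvars (output_pat l)" using well_scoped_output[OF wsl] f by blast
    \<comment> \<open>Since \<open>f\<close> is used in \<open>l\<close>, the set passed on is
      non-empty even if no variable of \<open>V\<close> is free in \<open>l\<close>.\<close>
    obtain p2 e2 l2 where VA: "VA A l ?U = LLet p2 e2 l2" and g: "gathered A l ?U p2 e2 l2"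
      using IH[of ?U] fl fo Vo by blast
    let ?l' = "LLet (ppair (ppos p1) p2) (ELet p1 e1 (epair (ppos p1) e2)) l2"
    have q: "pvars (ppos p1) \<subseteq> pvars p1" "\<forall>v\<in>pvars (ppos p1). \<not> arrow_var v"
      by (auto simp: ppos_def)
    have S: "pvars p1 - pvars (ppos p1) = {f}"
      unfolding ppos_diff using f au by auto
    have mg: "refines A ?L ?l'" "?W \<inter> FVl l2 = {}"
      "Facts ?l' = elim ?W {f} (add_mset (Fact p1 e1) (Facts l))"
      by (rule merge_gathered[OF ws A q g _ _ _ _ , where W = ?W, unfolded S];
        use fl V arrow(1) f in blast)+
    \<comment> \<open>The factor left after eliminating \<open>f\<close> still meets
      \<open>V\<close> through \<open>e1\<close>, so eliminating \<open>f\<close> and gathering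
      \<open>V\<close> fuse into the one operation that merging performs.\<close>
    have "elim V {} (elim {f} {f} (add_mset (Fact p1 e1) (Facts l)))
        = elim ({f} \<union> V) ({} \<union> {f}) (add_mset (Fact p1 e1) (Facts l))"
      by (rule elim_elim_linked) (use f arrow(1) Vp in auto)
    then have "Facts ?l' = elim V {} (Facts ?L)"
      using mg(3) by (simp add: Facts_LLet[OF ws] velim_def arrow(2))
    moreover have "?U \<subseteq> FV e2" using g by (simp add: gathered_def)
    then have "V \<subseteq> FV (ELet p1 e1 (epair (ppos p1) e2))"
      unfolding FV.simps FV_epair using V Vp by blast
    ultimately have "gathered A ?L V (ppair (ppos p1) p2) (ELet p1 e1 (epair (ppos p1) e2)) l2"
      using mg(1,2) unfolding gathered_def by blast
    with arrow LLet.prems(6) VA show ?thesis by simp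
  qed
qed

text \<open>By induction down to the definition of \<open>x\<close>. Eliminating \<open>x\<close>
  commutes with each definition passed on the way; at its own definition, gathering forms the
  product and merging sums out \<open>x\<close>.\<close>

lemma VE_L_aux_correct:
  assumes "well_scoped l" "arrows_used l" "finite A" "FVl l \<union> defined_vars l \<subseteq> A"
    "x \<in> defined_vars l" "pos_var x" "x \<notin> pvars (output_pat l)"
  shows "\<exists>p e l'. VE_L_aux A l x = LLet p e l' \<and> refines A l (LLet p e l') \<and>
     Facts (LLet p e l') = VE_F (Facts l) x"
  using assms
proof (induction l)
  case (Out w)
  then show ?case by simp
next
  case (LLet p1 e1 l)
  let ?L = "LLet p1 e1 l"
  let ?F = "add_mset (Fact p1 e1) (Facts l)"
  note ws = LLet.prems(1)
  have wsl: "well_scoped l" and d1: "pvars p1 \<inter> FV e1 = {}" "pvars p1 \<inter> defined_vars l = {}"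
    "FV e1 \<inter> defined_vars l = {}"
    and au: "\<forall>u\<in>pvars p1. \<forall>v\<in>pvars p1. arrow_var u \<longrightarrow> arrow_var v \<longrightarrow> u = v"
    using ws by auto
  have ok: "\<forall>v\<in>pvars p1. pos_var v \<or> arrow_var v" and use: "\<forall>v\<in>pvars p1. arrow_var v \<longrightarrow> v \<in> FVl l"
    and aul: "arrows_used l"
    using LLet.prems(2) by auto
  have A: "pvars p1 \<union> FV e1 \<union> FVl l \<subseteq> A" and Al: "FVl l \<union> defined_vars l \<subseteq> A"
    using LLet.prems(4) by auto
  have xo: "x \<notin> pvars (output_pat l)" using LLet.prems(7) by simp
  have xa: "\<not> arrow_var x" using pos_not_arrow[OF LLet.prems(6)] .
  have m: "mvars (Facts l) \<subseteq> FVl l \<union> defined_vars l"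
    using mvars_Facts[OF wsl] by auto
  let ?q = "pdel x p1"
  have q: "pvars ?q = pvars p1 - {x}" by (auto simp: pdel_def)
  \<comment> \<open>\<open>x\<close> is positive, so deleting it leaves the arrow variable in
    place.\<close>
  have pq: "parrow ?q = parrow p1"
    by (rule parrow_eqI) (use q xa au in auto)
  consider (later) "x \<notin> pvars p1"
    | (unused) "x \<in> pvars p1" "x \<notin> FVl l"
    | (pos) "x \<in> pvars p1" "x \<in> FVl l" "parrow p1 = None"
    | (arrow) f where "x \<in> pvars p1" "x \<in> FVl l" "parrow p1 = Some f"
    by (cases "parrow p1") auto
  then show ?case
  proof cases
    case later
    then have xd: "x \<in> defined_vars l" using LLet.prems(5) by simp
    with LLet.IH[OF wsl aul \<open>finite A\<close> Al _ LLet.prems(6) xo] obtain p2 e2 l2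
      where VE: "VE_L_aux A l x = LLet p2 e2 l2" and r2: "refines A l (LLet p2 e2 l2)"
        and F2: "Facts (LLet p2 e2 l2) = VE_F (Facts l) x" by blast
    let ?L2 = "LLet p1 e1 (LLet p2 e2 l2)"
    have r: "refines A ?L ?L2"
      by (rule refines_LLet[OF r2 ws]) (use A in blast)
    then have ws2: "well_scoped ?L2" by (simp add: refines_def)
    from SD_correct[OF ws2 ok \<open>finite A\<close>] obtain p e l'
      where SD: "SD A ?L2 = LLet p e l'" and r': "refines A ?L2 (LLet p e l')"
        and F: "Facts (LLet p e l') = Facts ?L2"
        and "\<forall>V. V \<subseteq> FV e2 \<longrightarrow> V \<inter> (FV e1 \<union> pvars p1 \<union> FVl l2) = {}
          \<longrightarrow> V \<subseteq> FV e \<and> V \<inter> FVl l' = {}"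
      by (elim exE conjE)
    have "Facts ?L2 = velim (parrow p1) (add_mset (Fact p1 e1) (elim {x} {x} (Facts l)))"
      by (simp only: Facts_LLet[OF ws2] F2 VE_F_elim)
    \<comment> \<open>Being defined in the tail, \<open>x\<close> cannot be free in
      \<open>e1\<close>.\<close>
    also have "add_mset (Fact p1 e1) (elim {x} {x} (Facts l)) = elim {x} {x} ?F"
      by (rule elim_add_disjoint[symmetric]) (use later xd d1 in auto)
    also have "velim (parrow p1) \<dots> = elim {x} {x} (velim (parrow p1) ?F)"
      by (rule velim_elim) (use later set_parrow[OF au] in auto)
    finally have "Facts ?L2 = VE_F (Facts ?L) x"
      by (simp only: Facts_LLet[OF ws] VE_F_elim)
    moreover have "VE_L_aux A ?L x = LLet p e l'"
      using later SD by (simp add: VE del: SD.simps)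
    ultimately show ?thesis using F refines_trans[OF r r'] by simp
  next
    case unused
    let ?l' = "LLet ?q (ELet p1 e1 (pexp ?q)) l"
    have xd: "x \<notin> defined_vars l" using unused d1 by blast
    have VE: "VE_L_aux A ?L x = ?l'" using unused by (simp add: Let_def)
    have "FV (ELet p1 e1 (pexp ?q)) = FV e1" using q by auto
    then have ws': "well_scoped ?l'"
      using ws q by (auto simp: FVa_def)
    have "FVl ?l' \<subseteq> FVl ?L" using q unused(2) by auto
    with ws' q have r: "refines A ?L ?l'" by (auto simp: refines_def)
    \<comment> \<open>Only the first factor contains \<open>x\<close>, so eliminating
      \<open>x\<close> just sums it out there.\<close>
    have "mvars (Facts l) \<inter> {x} = {}" using m xd unused(2) by blast
    moreover have "fprods {#Fact p1 e1#} = Fact p1 e1"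
      by (simp add: Fact_def fprods_single)
    moreover have "Fact ?q (ELet p1 e1 (pexp ?q)) = fsum {x} (Fact p1 e1)"
    proof -
      have "pvars p1 - pvars ?q = {x}" using q unused(1) by auto
      with Fact_drop[of ?q p1 e1] q d1(1) show ?thesis by simp
    qed
    ultimately have "add_mset (Fact ?q (ELet p1 e1 (pexp ?q))) (Facts l) = elim {x} {x} ?F"
      using unused(1) by (simp add: elim_def touching_disjoint avoiding_disjoint)
    then have "Facts ?l' = velim (parrow p1) (elim {x} {x} ?F)"
      by (simp only: Facts_LLet[OF ws'] pq)
    also have "\<dots> = elim {x} {x} (velim (parrow p1) ?F)"
      by (rule velim_elim) (use xa set_parrow[OF au] in auto)
    finally have "Facts ?l' = VE_F (Facts ?L) x"
      by (simp only: Facts_LLet[OF ws] VE_F_elim)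
    with VE r show ?thesis by blast
  next
    case pos
    obtain p2 e2 l2 where VA: "VA A l {x} = LLet p2 e2 l2" and g: "gathered A l {x} p2 e2 l2"
      using VA_correct[OF wsl aul \<open>finite A\<close> Al, of "{x}"] pos(2) xo by blast
    let ?l' = "LLet (ppair ?q p2) (ELet p1 e1 (epair ?q e2)) l2"
    have q': "pvars ?q \<subseteq> pvars p1" "\<forall>v\<in>pvars ?q. \<not> arrow_var v"
      using q pos(3) by (auto simp: parrow_None)
    have S: "pvars p1 - pvars ?q = {x}" using q pos(1) by auto
    have mg: "refines A ?L ?l'" "Facts ?l' = elim {x} {x} ?F"
      by (rule merge_gathered[OF ws A q' g _ _ _ _ , where W = "{x}", unfolded S];
        use pos in blast)+
    then have "Facts ?l' = VE_F (Facts ?L) x"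
      by (simp add: Facts_LLet[OF ws] velim_def pos(3) VE_F_elim)
    moreover have "VE_L_aux A ?L x = ?l'"
      using pos by (simp add: Let_def pq VA)
    ultimately show ?thesis using mg(1) by blast
  next
    case arrow
    let ?q' = "ppos ?q"
    have f: "f \<in> pvars p1" "arrow_var f" using parrow_Some[OF arrow(3)] by auto
    have fl: "f \<in> FVl l" using f use by blast
    have fo: "f \<notin> pvars (output_pat l)" using well_scoped_output[OF wsl] f by blast
    have fx: "f \<noteq> x" using f xa by blast
    obtain p2 e2 l2 where VA: "VA A l {x, f} = LLet p2 e2 l2" and g: "gathered A l {x, f} p2 e2 l2"
      using VA_correct[OF wsl aul \<open>finite A\<close> Al, of "{x, f}"] arrow(2) xo fl fo by blast
    let ?l' = "LLet (ppair ?q' p2) (ELet p1 e1 (epair ?q' e2)) l2"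
    have q': "pvars ?q' \<subseteq> pvars p1" "\<forall>v\<in>pvars ?q'. \<not> arrow_var v"
      using q by (auto simp: ppos_def)
    have "pvars ?q' = {v \<in> pvars p1 - {x}. \<not> arrow_var v}" using q by (auto simp: ppos_def)
    then have S: "pvars p1 - pvars ?q' = {x, f}" using arrow(1) f au by auto
    have mg: "refines A ?L ?l'" "Facts ?l' = elim {x, f} {x, f} ?F"
      by (rule merge_gathered[OF ws A q' g _ _ _ _ , where W = "{x, f}", unfolded S];
        use arrow(1,2) fl in blast)+
    \<comment> \<open>The factor of \<open>p1\<close> contains both variables, so the product left
      after eliminating \<open>f\<close> still contains \<open>x\<close> and the eliminations
      fuse.\<close>
    have "elim {x} {x} (elim {f} {f} ?F) = elim ({f} \<union> {x}) ({x} \<union> {f}) ?F"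
      by (rule elim_elim_linked) (use f arrow(1) fx in auto)
    then have "Facts ?l' = VE_F (Facts ?L) x"
      using mg(2) by (simp add: Facts_LLet[OF ws] velim_def arrow(3) VE_F_elim insert_commute)
    moreover have "VE_L_aux A ?L x = ?l'"
      using arrow by (simp add: Let_def pq VA)
    ultimately show ?thesis using mg(1) by blast
  qed
qed

section \<open>Typing\<close>

text \<open>The left component of a pair has positive type, so an arrow variable can come only from
  the right one; hence there is at most one. The empty pattern has no type.\<close>

lemma wt_pexp:
  "wt (pexp p) T \<Longrightarrow> (\<forall>v\<in>pvars p. var_ok v) \<and> (positive T \<longrightarrow> (\<forall>v\<in>pvars p. pos_var v)) \<and>
     (\<forall>u\<in>pvars p. \<forall>v\<in>pvars p. arrow_var u \<longrightarrow> arrow_var v \<longrightarrow> u = v)"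
proof (induction p arbitrary: T)
  case (PVar v)
  from PVar.prems have "wt (EVar v) T" by simp
  then show ?case by cases (auto simp: pos_var_def)
next
  case (PPair p q)
  from PPair.prems have "wt (EPair (pexp p) (pexp q)) T" by simp
  then obtain P T' where w: "T = Tens P T'" "wt (pexp p) P" "positive P" "wt (pexp q) T'"
    by cases auto
  with PPair.IH(1)[OF w(2)] PPair.IH(2)[OF w(4)] show ?case
    using pos_not_arrow by (auto simp: ball_Un)
next
  case PUnit
  then have "wt EUnit T" by simp
  then show ?case by cases
qed

text \<open>Typing supplies linearity and the use of arrow variables; the variable convention keeps
  bound names apart from each other and from free ones.\<close>

lemma wt_well_scoped:
  assumes "wt (lexp l) T" "var_convention (lexp l)" "pos_pat (output_pat l)"
  shows "well_scoped l \<and> arrows_used l"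
  using assms
proof (induction l arbitrary: T)
  case (Out w)
  then show ?case using pos_not_arrow by (auto simp: pos_pat_def)
next
  case (LLet p e l)
  from LLet.prems(1) have "wt (ELet p e (lexp l)) T" by simp
  then obtain P where w: "wt (pexp p) P" "wt (lexp l) T" "FVa e \<inter> FVa (lexp l) = {}"
      "\<And>f. f \<in> pvars p \<Longrightarrow> arrow_var f \<Longrightarrow> f \<in> FVa (lexp l)"
    by cases auto
  have c: "distinct (bv_list (lexp l))" "pvars p \<inter> set (bv_list (lexp l)) = {}"
    "pvars p \<inter> FV e = {}" "set (bv_list (lexp l)) \<inter> (FV e \<union> (FVl l - pvars p)) = {}"
    using LLet.prems(2) by (auto simp: var_convention_def pvars_def FVl_def)
  \<comment> \<open>A free variable of the tail is either bound by \<open>p\<close>, hence not bound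
    again, or free in the whole term.\<close>
  then have "var_convention (lexp l)"
    by (auto simp: var_convention_def FVl_def)
  with LLet.IH[OF w(2)] LLet.prems(3) have IH: "well_scoped l" "arrows_used l" by auto
  have "(pvars p \<union> FV e) \<inter> defined_vars l = {}"
    using c defined_vars_bv[of l] by blast
  moreover have "FVa e \<inter> FVl l = {}"
    using w(3) by (auto simp: FVa_def FVl_def)
  moreover have "\<forall>v\<in>pvars p. pos_var v \<or> arrow_var v" "\<forall>v\<in>pvars p. arrow_var v \<longrightarrow> v \<in> FVl l"
    using wt_pexp[OF w(1)] w(4) by (auto simp: var_ok_def FVa_def FVl_def)
  moreover have "\<forall>u\<in>pvars p. \<forall>v\<in>pvars p. arrow_var u \<longrightarrow> arrow_var v \<longrightarrow> u = v"
    using wt_pexp[OF w(1)] by blast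
  ultimately show ?case using IH c(3) by simp
qed

theorem theorem1:
  fixes l :: lterm and x :: var and T :: ty
  assumes "wt_lterm l T"
    and "var_convention (lexp l)"
    and "pos_lterm l"
    and "pos_var x"
    and "x \<in> defined_vars l"
    and "x \<notin> pvars (output_pat l)"
  shows "Facts (VE_L l x) = VE_F (Facts l) x"
proof -
  have ws: "well_scoped l" "arrows_used l"
    using wt_well_scoped assms(1-3) by (auto simp: wt_lterm_def pos_lterm_def)
  have "FVl l \<union> defined_vars l \<subseteq> all_vars l"
    using defined_vars_bv[of l] by (auto simp: all_vars_def)
  \<comment> \<open>With \<open>A\<close> the set of all variables of \<open>l\<close>, every
    abstraction variable is new for the whole term.\<close>
  from VE_L_aux_correct[OF ws finite_all_vars this assms(5,4,6)] show ?thesis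
    by (auto simp: VE_L_def)
qed

end
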